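(* Let $n\ge 1$, $1<p\le 1+\frac{2}{n}$ and $\mu>1$. Let $(u_0,u_1)\in H^1(\mathbf{R}^n)\times L^2(\mathbf{R}^n)$ have compact support and satisfy $$\int_{\mathbf{R}^n}\bigl((\mu-1)u_0(x)+u_1(x)\bigr)\,dx>0.$$ Then there is no global solution of the Cauchy problem $$u_{tt}-\Delta u+\frac{\mu}{1+t}u_t=|u|^p\ \text{ in }(0,\infty)\times\mathbf{R}^n,\qquad (u,u_t)(0,x)=(u_0,u_1)(x).$$
   Context: All functions are real-valued. A global solution is a function $u\in C([0,\infty);H^1(\mathbf{R}^n))\cap C^1([0,\infty);L^2(\mathbf{R}^n))$ satisfying the equation in the sense of distributions on $(0,\infty)\times\mathbf{R}^n$, with the initial data attained in $H^1(\mathbf{R}^n)\times L^2(\mathbf{R}^n)$. *)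

theory Defs
  imports "HOL-Analysis.Analysis"
begin

definition dir_deriv :: "'a::euclidean_space \<Rightarrow> ('a \<Rightarrow> real) \<Rightarrow> 'a \<Rightarrow> real" where
  "dir_deriv v f x = frechet_derivative f (at x) v"

primrec C_k :: "nat \<Rightarrow> ('a::euclidean_space \<Rightarrow> real) \<Rightarrow> bool" where
  "C_k 0 f \<longleftrightarrow> continuous_on UNIV f"
| "C_k (Suc k) f \<longleftrightarrow> (\<forall>x. f differentiable (at x)) \<and> (\<forall>v. C_k k (dir_deriv v f))"

(* C_c^infinity(S) for an open set S, each function being extended by zero outside S. *)
definition test_function :: "'a::euclidean_space set \<Rightarrow> ('a \<Rightarrow> real) \<Rightarrow> bool" where
  "test_function S \<phi> \<longleftrightarrow> (\<forall>k. C_k k \<phi>) \<and> (\<exists>K. compact K \<and> K \<subseteq> S \<and> (\<forall>x. x \<notin> K \<longrightarrow> \<phi> x = 0))"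

(* Elements of L^2 and H^1 are represented by functions; equality in these spaces is
   equality almost everywhere. *)
definition in_L2 :: "('a::euclidean_space \<Rightarrow> real) \<Rightarrow> bool" where
  "in_L2 f \<longleftrightarrow> f \<in> borel_measurable lebesgue \<and> integrable lebesgue (\<lambda>x. (f x)\<^sup>2)"

definition L2_norm :: "('a::euclidean_space \<Rightarrow> real) \<Rightarrow> real" where
  "L2_norm f = sqrt (LINT x|lebesgue. (f x)\<^sup>2)"

definition is_weak_deriv :: "'a::euclidean_space \<Rightarrow> ('a \<Rightarrow> real) \<Rightarrow> ('a \<Rightarrow> real) \<Rightarrow> bool" where
  "is_weak_deriv v f g \<longleftrightarrow>
     (\<forall>\<psi>. test_function UNIV \<psi> \<longrightarrow>
        (LINT x|lebesgue. f x * dir_deriv v \<psi> x) = - (LINT x|lebesgue. g x * \<psi> x))"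

definition in_H1 :: "('a::euclidean_space \<Rightarrow> real) \<Rightarrow> bool" where
  "in_H1 f \<longleftrightarrow> in_L2 f \<and> (\<forall>b\<in>Basis. \<exists>g. in_L2 g \<and> is_weak_deriv b f g)"

(* An L^2 weak derivative is unique almost everywhere, so for f in H^1 the choice made here
   does not affect H1_norm. *)
definition weak_deriv :: "'a::euclidean_space \<Rightarrow> ('a \<Rightarrow> real) \<Rightarrow> 'a \<Rightarrow> real" where
  "weak_deriv v f = (SOME g. in_L2 g \<and> is_weak_deriv v f g)"

definition H1_norm :: "('a::euclidean_space \<Rightarrow> real) \<Rightarrow> real" where
  "H1_norm f = sqrt ((L2_norm f)\<^sup>2 + (\<Sum>b\<in>Basis. (L2_norm (weak_deriv b f))\<^sup>2))"

definition continuous_H1 :: "(real \<Rightarrow> 'a::euclidean_space \<Rightarrow> real) \<Rightarrow> bool" where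
  "continuous_H1 u \<longleftrightarrow> (\<forall>t\<ge>0. in_H1 (u t)) \<and>
     (\<forall>t\<ge>0. ((\<lambda>s. H1_norm (\<lambda>x. u s x - u t x)) \<longlongrightarrow> 0) (at t within {0..}))"

definition continuous_L2 :: "(real \<Rightarrow> 'a::euclidean_space \<Rightarrow> real) \<Rightarrow> bool" where
  "continuous_L2 v \<longleftrightarrow> (\<forall>t\<ge>0. in_L2 (v t)) \<and>
     (\<forall>t\<ge>0. ((\<lambda>s. L2_norm (\<lambda>x. v s x - v t x)) \<longlongrightarrow> 0) (at t within {0..}))"

definition has_L2_time_deriv ::
    "(real \<Rightarrow> 'a::euclidean_space \<Rightarrow> real) \<Rightarrow> (real \<Rightarrow> 'a \<Rightarrow> real) \<Rightarrow> bool" where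
  "has_L2_time_deriv u v \<longleftrightarrow>
     (\<forall>t\<ge>0. ((\<lambda>s. L2_norm (\<lambda>x. (u s x - u t x) / (s - t) - v t x)) \<longlongrightarrow> 0) (at t within {0..}))"

definition time_deriv :: "(real \<times> 'a::euclidean_space \<Rightarrow> real) \<Rightarrow> real \<times> 'a \<Rightarrow> real" where
  "time_deriv = dir_deriv (1, 0)"

definition space_laplacian :: "(real \<times> 'a::euclidean_space \<Rightarrow> real) \<Rightarrow> real \<times> 'a \<Rightarrow> real" where
  "space_laplacian \<phi> z = (\<Sum>b\<in>Basis. dir_deriv (0, b) (dir_deriv (0, b) \<phi>) z)"

(* The equation in D'((0,infinity) x R^n), every derivative being moved to the test function.
   Pairings are iterated integrals, which do not depend on the representatives chosen for the
   classes u(t); no joint measurability in (t,x) is needed. The first two conjuncts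
   say that the pairing with |u|^p converges, that is, that |u|^p is locally integrable and
   defines a distribution. *)
definition distributional_solution ::
    "real \<Rightarrow> real \<Rightarrow> (real \<Rightarrow> 'a::euclidean_space \<Rightarrow> real) \<Rightarrow> bool" where
  "distributional_solution \<mu> p u \<longleftrightarrow>
     (\<forall>\<phi>. test_function ({0<..} \<times> UNIV) \<phi> \<longrightarrow>
        (AE t in lebesgue. t > 0 \<longrightarrow> integrable lebesgue (\<lambda>x. \<bar>u t x\<bar> powr p * \<phi> (t, x))) \<and>
        set_integrable lebesgue {0<..} (\<lambda>t. LINT x|lebesgue. \<bar>u t x\<bar> powr p * \<phi> (t, x)) \<and>
        (LINT t:{0<..}|lebesgue. LINT x|lebesgue.
           u t x * (time_deriv (time_deriv \<phi>) (t, x) - space_laplacian \<phi> (t, x)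
                    - time_deriv (\<lambda>(s, y). \<mu> / (1 + s) * \<phi> (s, y)) (t, x)))
        = (LINT t:{0<..}|lebesgue. LINT x|lebesgue. \<bar>u t x\<bar> powr p * \<phi> (t, x)))"

(* v is the derivative u_t of u as an L^2-valued map. *)
definition global_solution ::
    "real \<Rightarrow> real \<Rightarrow> ('a::euclidean_space \<Rightarrow> real) \<Rightarrow> ('a \<Rightarrow> real) \<Rightarrow> (real \<Rightarrow> 'a \<Rightarrow> real) \<Rightarrow> bool" where
  "global_solution \<mu> p u0 u1 u \<longleftrightarrow>
     continuous_H1 u \<and> distributional_solution \<mu> p u \<and>
     (AE x in lebesgue. u 0 x = u0 x) \<and>
     (\<exists>v. continuous_L2 v \<and> has_L2_time_deriv u v \<and> (AE x in lebesgue. v 0 x = u1 x))"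

definition compactly_supported :: "('a::euclidean_space \<Rightarrow> real) \<Rightarrow> bool" where
  "compactly_supported f \<longleftrightarrow> (\<exists>K. compact K \<and> (AE x in lebesgue. x \<notin> K \<longrightarrow> f x = 0))"

end

theory Submission
  imports Defs "HOL-Computational_Algebra.Polynomial"
begin

text \<open>
  The proof is by test functions. The factor \<open>1 + t\<close> annihilates the damping: if
  \<open>\<phi>(t, x) = (1 + t) w(t) \<chi>(x)\<close>, then
  \<open>\<phi>\<^sub>t\<^sub>t - (\<mu> \<phi> / (1 + t))\<^sub>t = ((1 + t) w'' + (2 - \<mu>) w') \<chi>\<close>, with no zeroth order term in \<open>w\<close>.
  Let \<open>w = 1\<close> up to time \<open>R\<close> and \<open>\<chi> = 1\<close> on the ball of radius \<open>R\<close>, both vanishing beyond \<open>2 R\<close>.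
  Then the equation tested with \<open>\<phi>\<close> says that
  \<open>\<integral>\<integral> (1 + t) |u|\<^sup>p w \<chi> + \<integral> ((\<mu> - 1) u\<^sub>0 + u\<^sub>1) \<chi>\<close> equals an integral of \<open>u\<close> against a function of
  size \<open>(1 + t) R\<^sup>-\<^sup>2 (w \<chi>)\<^sup>1\<^sup>/\<^sup>p\<close> that lives where \<open>t > R\<close> or \<open>|x| > R\<close>. By Young's
  inequality this is at most
  \<open>l J + l\<^sup>-\<^sup>1\<^sup>/\<^sup>(\<^sup>p\<^sup>-\<^sup>1\<^sup>) D\<close> for every \<open>l > 0\<close>, where \<open>J\<close> is the part of the source
  \<open>\<integral>\<integral> (1 + t) |u|\<^sup>p w \<chi>\<close> outside the scale \<open>R / 2\<close>. The constant \<open>D\<close> does not depend on \<open>R\<close>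
  precisely because \<open>p \<le> 1 + 2 / n\<close> (lemma \<open>scaling\<close>).

  Along \<open>R = \<rho> 2\<^sup>j\<close> the sources \<open>J\<^sub>j\<close> therefore satisfy
  \<open>J\<^sub>j\<^sub>+\<^sub>1 + c \<le> l (J\<^sub>j\<^sub>+\<^sub>1 - J\<^sub>j) + l\<^sup>-\<^sup>1\<^sup>/\<^sup>(\<^sup>p\<^sup>-\<^sup>1\<^sup>) D\<close> with \<open>c > 0\<close>
  (lemma \<open>source_inequality\<close>). Small \<open>l\<close> bounds the sources, large \<open>l\<close> makes their increments
  bounded below, and these exclude each other (lemma \<open>no_sequence_with_source_inequality\<close>). Comparing
  with the difference of two scales, and not with \<open>J\<^sub>j\<^sub>+\<^sub>1\<close> itself, is what covers the critical
  exponent \<open>p = 1 + 2 / n\<close> along with the subcritical ones.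

  The test functions that are admitted vanish near \<open>t = 0\<close>. So \<open>w\<close> is a difference of two cutoffs
  and rises from \<open>0\<close> to \<open>1\<close> between \<open>\<epsilon>\<close> and \<open>2 \<epsilon>\<close>; as \<open>u\<close> is continuously differentiable in
  time with values in \<open>L\<^sup>2\<close>, the rise reproduces the initial data up to a small error
  (lemma \<open>boundary_term_ge\<close>). Since \<open>\<epsilon>\<close> may depend on \<open>R\<close>, no limit of integrals is needed.
\<close>

section \<open>A calculus of smooth functions\<close>

definition smooth :: "('a::euclidean_space \<Rightarrow> real) \<Rightarrow> bool" where
  "smooth f \<longleftrightarrow> (\<forall>k. C_k k f)"

lemma dir_deriv_eqI: "(f has_derivative D) (at x) \<Longrightarrow> dir_deriv v f x = D v"
  unfolding dir_deriv_def using frechet_derivative_at by metis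

text \<open>To show that a function is \<open>C\<^sup>k\<^sup>+\<^sup>1\<close> it suffices to exhibit a derivative by a formula and to
  apply an induction hypothesis on \<open>k\<close> to that formula. All closure properties below are proved
  so.\<close>

lemma C_k_SucI:
  assumes "\<And>x. (f has_derivative D x) (at x)" and "\<And>v. C_k k (\<lambda>x. D x v)"
  shows "C_k (Suc k) f"
proof -
  have "dir_deriv v f = (\<lambda>x. D x v)" for v
    using assms(1) by (simp add: dir_deriv_eqI fun_eq_iff)
  then show ?thesis using assms by (auto simp: differentiable_def C_k.simps(2))
qed

lemma C_k_SucD:
  assumes "C_k (Suc k) f"
  shows "(f has_derivative (\<lambda>v. dir_deriv v f x)) (at x)" and "C_k k (dir_deriv v f)"
  using assms by (auto simp: dir_deriv_def [abs_def] frechet_derivative_works)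

lemma C_k_lower: "C_k (Suc k) f \<Longrightarrow> C_k k f"
proof (induction k arbitrary: f)
  case 0
  then show ?case
    by (simp add: continuous_at_imp_continuous_on differentiable_imp_continuous_within)
next
  case (Suc k)
  then show ?case by (metis C_k.simps(2))
qed

declare C_k.simps(2) [simp del]

lemma C_k_const: "C_k k (\<lambda>x. c)"
proof (induction k arbitrary: c)
  case (Suc k)
  show ?case by (rule C_k_SucI[where D = "\<lambda>x v. 0"]) (use Suc in auto)
qed simp

lemma C_k_linear: "bounded_linear f \<Longrightarrow> C_k k f"
proof (induction k)
  case 0
  then show ?case by (simp add: linear_continuous_on)
next
  case (Suc k)
  show ?case
    by (rule C_k_SucI[where D = "\<lambda>x. f"])
      (use Suc.prems C_k_const in \<open>auto intro: bounded_linear_imp_has_derivative\<close>)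
qed

lemma C_k_add: "C_k k f \<Longrightarrow> C_k k g \<Longrightarrow> C_k k (\<lambda>x. f x + g x)"
proof (induction k arbitrary: f g)
  case 0
  then show ?case by (auto intro!: continuous_intros)
next
  case (Suc k)
  show ?case
    by (rule C_k_SucI[where D = "\<lambda>x v. dir_deriv v f x + dir_deriv v g x"])
      (use Suc.prems in \<open>auto intro!: has_derivative_add Suc.IH C_k_SucD\<close>)
qed

lemma C_k_mult: "C_k k f \<Longrightarrow> C_k k g \<Longrightarrow> C_k k (\<lambda>x. f x * g x)"
proof (induction k arbitrary: f g)
  case 0
  then show ?case by (auto intro!: continuous_intros)
next
  case (Suc k)
  show ?case
  proof (rule C_k_SucI[where D = "\<lambda>x v. f x * dir_deriv v g x + dir_deriv v f x * g x"])
    show "((\<lambda>x. f x * g x) has_derivative (\<lambda>v. f x * dir_deriv v g x + dir_deriv v f x * g x)) (at x)" for x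
      using C_k_SucD(1)[OF Suc.prems(1)] C_k_SucD(1)[OF Suc.prems(2)] by (rule has_derivative_mult)
    show "C_k k (\<lambda>x. f x * dir_deriv v g x + dir_deriv v f x * g x)" for v
      by (rule C_k_add[OF
          Suc.IH[OF C_k_lower[OF Suc.prems(1)] C_k_SucD(2)[OF Suc.prems(2)]]
          Suc.IH[OF C_k_SucD(2)[OF Suc.prems(1)] C_k_lower[OF Suc.prems(2)]]])
  qed
qed

lemma C_k_inverse:
  assumes "\<And>x. f x \<noteq> 0" "C_k k f" shows "C_k k (\<lambda>x. inverse (f x))"
  using assms(2)
proof (induction k)
  case 0
  then show ?case using assms(1) by (auto intro!: continuous_intros)
next
  case (Suc k)
  show ?case
  proof (rule C_k_SucI[where D = "\<lambda>x v. (- 1) * (inverse (f x) * dir_deriv v f x * inverse (f x))"])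
    show "((\<lambda>x. inverse (f x)) has_derivative (\<lambda>v. (- 1) * (inverse (f x) * dir_deriv v f x * inverse (f x)))) (at x)" for x
      using Deriv.has_derivative_inverse[OF assms(1) C_k_SucD(1)[OF Suc.prems]] by simp
    show "C_k k (\<lambda>x. (- 1) * (inverse (f x) * dir_deriv v f x * inverse (f x)))" for v
      by (rule C_k_mult[OF C_k_const C_k_mult[OF C_k_mult]])
        (fact Suc.IH[OF C_k_lower[OF Suc.prems]] C_k_SucD(2)[OF Suc.prems])+
  qed
qed

lemma C_k_compose_linear: "bounded_linear L \<Longrightarrow> C_k k f \<Longrightarrow> C_k k (\<lambda>x. f (L x))"
proof (induction k arbitrary: f)
  case 0
  then show ?case
    by (auto intro: continuous_on_compose2[of UNIV f] linear_continuous_on)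
next
  case (Suc k)
  show ?case
  proof (rule C_k_SucI[where D = "\<lambda>x v. dir_deriv (L v) f (L x)"])
    show "((\<lambda>x. f (L x)) has_derivative (\<lambda>v. dir_deriv (L v) f (L x))) (at x)" for x
      using has_derivative_compose[OF bounded_linear_imp_has_derivative[OF Suc.prems(1)]
          C_k_SucD(1)[OF Suc.prems(2)]] .
    show "C_k k (\<lambda>x. dir_deriv (L v) f (L x))" for v
      using Suc.IH[OF Suc.prems(1) C_k_SucD(2)[OF Suc.prems(2)]] .
  qed
qed

lemma C_k_compose_real:
  fixes h :: "real \<Rightarrow> real"
  shows "C_k k h \<Longrightarrow> C_k k f \<Longrightarrow> C_k k (\<lambda>x. h (f x))"
proof (induction k arbitrary: h)
  case 0
  then show ?case by (auto intro: continuous_on_compose2[of UNIV h])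
next
  case (Suc k)
  have lin: "dir_deriv a h y = a * dir_deriv 1 h y" for a y
  proof -
    have "linear (\<lambda>v. dir_deriv v h y)"
      using C_k_SucD(1)[OF Suc.prems(1)] has_derivative_linear by blast
    from linear_cmul[OF this, of a 1] show ?thesis by simp
  qed
  show ?case
  proof (rule C_k_SucI[where D = "\<lambda>x v. dir_deriv v f x * dir_deriv 1 h (f x)"])
    show "((\<lambda>x. h (f x)) has_derivative (\<lambda>v. dir_deriv v f x * dir_deriv 1 h (f x))) (at x)" for x
      using has_derivative_compose[OF C_k_SucD(1)[OF Suc.prems(2)] C_k_SucD(1)[OF Suc.prems(1)]]
      by (subst (asm) lin)
    show "C_k k (\<lambda>x. dir_deriv v f x * dir_deriv 1 h (f x))" for v
      by (rule C_k_mult[OF C_k_SucD(2)[OF Suc.prems(2)]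
          Suc.IH[OF C_k_SucD(2)[OF Suc.prems(1)] C_k_lower[OF Suc.prems(2)]]])
  qed
qed

lemma smooth_const : "smooth (\<lambda>x. c)"
  and smooth_linear: "bounded_linear f \<Longrightarrow> smooth f"
  and smooth_add : "smooth f \<Longrightarrow> smooth g \<Longrightarrow> smooth (\<lambda>x. f x + g x)"
  and smooth_mult : "smooth f \<Longrightarrow> smooth g \<Longrightarrow> smooth (\<lambda>x. f x * g x)"
  and smooth_inverse: "(\<And>x. f x \<noteq> 0) \<Longrightarrow> smooth f \<Longrightarrow> smooth (\<lambda>x. inverse (f x))"
  and smooth_compose_linear: "bounded_linear L \<Longrightarrow> smooth f \<Longrightarrow> smooth (\<lambda>x. f (L x))"
  and smooth_compose_real: "smooth h \<Longrightarrow> smooth f \<Longrightarrow> smooth (\<lambda>x. h (f x))"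
  unfolding smooth_def
  by (auto simp add: C_k_const C_k_linear C_k_add C_k_mult C_k_inverse C_k_compose_linear
      C_k_compose_real)

lemma smooth_ident : "smooth (\<lambda>x::real. x)"
  by (rule smooth_linear) (rule bounded_linear_ident)

lemma smooth_uminus : "smooth f \<Longrightarrow> smooth (\<lambda>x. - f x)"
  using smooth_mult[OF smooth_const[of "- 1"]] by simp

lemma smooth_diff : "smooth f \<Longrightarrow> smooth g \<Longrightarrow> smooth (\<lambda>x. f x - g x)"
  using smooth_add[OF _ smooth_uminus] by simp

lemma smooth_power : "smooth f \<Longrightarrow> smooth (\<lambda>x. f x ^ n)"
  by (induction n) (auto intro: smooth_const smooth_mult)

lemma smooth_cmult_arg: "smooth f \<Longrightarrow> smooth (\<lambda>t. f (c * t))" for f :: "real \<Rightarrow> real"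
  using smooth_compose_real[of f "\<lambda>t. c * t", OF _ smooth_mult[OF smooth_const smooth_ident]] .

lemma smooth_sum: "(\<And>i. i \<in> I \<Longrightarrow> smooth (f i)) \<Longrightarrow> smooth (\<lambda>x. \<Sum>i\<in>I. f i x)"
  by (induction I rule: infinite_finite_induct) (auto intro: smooth_const smooth_add)

lemma smooth_norm_square: "smooth (\<lambda>x::'a::euclidean_space. (norm x)\<^sup>2)"
proof -
  have "(\<lambda>x::'a. (norm x)\<^sup>2) = (\<lambda>x. \<Sum>b\<in>Basis. (x \<bullet> b)\<^sup>2)"
    by (subst power2_norm_eq_inner, subst euclidean_inner) (simp add: fun_eq_iff power2_eq_square)
  then show ?thesis
    by (simp add: smooth_sum smooth_power smooth_linear bounded_linear_inner_left)
qed

lemma smooth_continuous: "smooth f \<Longrightarrow> continuous_on UNIV f"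
  unfolding smooth_def by (metis C_k.simps(1))

lemma smooth_dir_deriv: "smooth f \<Longrightarrow> smooth (dir_deriv v f)"
  unfolding smooth_def using C_k_SucD(2) by blast

lemma smooth_has_real_derivative:
  assumes "smooth f" shows "(f has_real_derivative dir_deriv 1 f t) (at t)"
proof -
  have der: "(f has_derivative (\<lambda>v. dir_deriv v f t)) (at t)"
    using assms unfolding smooth_def using C_k_SucD(1) by blast
  have "(\<lambda>v. dir_deriv v f t) = (*) (dir_deriv 1 f t)"
    using linear_cmul[OF has_derivative_linear[OF der], of v 1 for v]
    by (intro ext) (metis mult.commute mult.right_neutral real_scaleR_def)
  with der show ?thesis
    by (simp only: has_field_derivative_def)
qed

text \<open>The difference quotients from the left vanish, which settles the endpoint \<open>s = a\<close> as well.\<close>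

lemma smooth_deriv_zero_left:
  fixes f :: "real \<Rightarrow> real"
  assumes "smooth f" and "\<And>s. s \<le> a \<Longrightarrow> f s = c" and "s \<le> a"
  shows "dir_deriv 1 f s = 0"
proof -
  have "((\<lambda>y. (f y - f s) / (y - s)) \<longlongrightarrow> dir_deriv 1 f s) (at_left s)"
    using DERIV_subset[OF smooth_has_real_derivative[OF assms(1), of s], of "{..<s}"]
    by (simp add: has_field_derivative_iff)
  moreover have "\<forall>\<^sub>F y in at_left s. 0 = (f y - f s) / (y - s)"
    by (rule eventually_at_leftI[of "s - 1"]) (use assms(2,3) in auto)
  then have "((\<lambda>y. (f y - f s) / (y - s)) \<longlongrightarrow> 0) (at_left s)"
    by (rule tendsto_eventually[OF eventually_mono]) auto
  ultimately show ?thesis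
    using tendsto_unique trivial_limit_at_left_real by blast
qed

lemma smooth_fst: "smooth f \<Longrightarrow> smooth (\<lambda>z::real \<times> 'a::euclidean_space. f (fst z))"
  by (rule smooth_compose_linear[OF bounded_linear_fst])

lemma smooth_snd: "smooth g \<Longrightarrow> smooth (\<lambda>z::real \<times> 'a::euclidean_space. g (snd z))"
  by (rule smooth_compose_linear[OF bounded_linear_snd])

section \<open>A smooth step\<close>

text \<open>The functions \<open>p(1/t) exp(-1/t)\<close>, extended by zero, form a family that is closed under
  differentiation: with \<open>y = 1/t\<close>, the polynomial \<open>p\<close> becomes \<open>y\<^sup>2 (p - p')\<close>. This gives all
  derivatives of \<open>exp(-1/t)\<close> by induction.\<close>

definition flat :: "real poly \<Rightarrow> real \<Rightarrow> real" where
  "flat q t = (if t \<le> 0 then 0 else poly q (1 / t) * exp (- (1 / t)))"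

lemma poly_times_exp_tendsto_0: "((\<lambda>y::real. poly q y * exp (- y)) \<longlongrightarrow> 0) at_top"
proof -
  have "((\<lambda>y::real. \<Sum>i\<le>degree q. coeff q i * (y ^ i / exp y)) \<longlongrightarrow> (\<Sum>i\<le>degree q. coeff q i * 0)) at_top"
    by (intro tendsto_sum tendsto_mult tendsto_const tendsto_power_div_exp_0)
  then show ?thesis
    by (simp add: poly_altdef sum_distrib_right exp_minus divide_inverse mult.assoc)
qed

lemma flat_tendsto_0: "(flat q \<longlongrightarrow> 0) (at_right 0)"
proof -
  have "((\<lambda>t. poly q (inverse t) * exp (- inverse t)) \<longlongrightarrow> 0) (at_right (0::real))"
    by (rule filterlim_compose[OF poly_times_exp_tendsto_0 filterlim_inverse_at_top_right])
  moreover have "\<forall>\<^sub>F t in at_right 0. poly q (inverse t) * exp (- inverse t) = flat q t"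
    by (rule eventually_at_rightI[of 0 1]) (auto simp: flat_def inverse_eq_divide)
  ultimately show ?thesis by (rule Lim_transform_eventually)
qed

lemma flat_has_derivative:
  "(flat q has_real_derivative flat ([:0, 0, 1:] * (q - pderiv q)) t) (at t)"
proof -
  let ?q' = "[:0, 0, 1:] * (q - pderiv q)"
  consider "t < 0" | "t = 0" | "t > 0" by linarith
  then show ?thesis
  proof cases
    case 1
    have "((\<lambda>t. 0) has_real_derivative flat ?q' t) (at t)"
      using 1 by (simp add: flat_def)
    then show ?thesis
      by (rule has_field_derivative_transform_within_open[of _ _ _ "{..<0}"])
        (use 1 in \<open>auto simp: flat_def\<close>)
  next
    case 2
    have "((\<lambda>y. (flat q y - flat q 0) / (y - 0)) \<longlongrightarrow> 0) (at_right 0)"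
    proof (rule Lim_transform_eventually[OF flat_tendsto_0[of "[:0, 1:] * q"]])
      show "\<forall>\<^sub>F y in at_right 0. flat ([:0, 1:] * q) y = (flat q y - flat q 0) / (y - 0)"
        by (rule eventually_at_rightI[of 0 1]) (auto simp: flat_def)
    qed
    moreover have "((\<lambda>y. (flat q y - flat q 0) / (y - 0)) \<longlongrightarrow> 0) (at_left 0)"
    proof (rule Lim_transform_eventually[OF tendsto_const])
      show "\<forall>\<^sub>F y in at_left 0. 0 = (flat q y - flat q 0) / (y - 0)"
        by (rule eventually_at_leftI[of "-1"]) (auto simp: flat_def)
    qed
    ultimately show ?thesis
      using 2 by (simp add: has_field_derivative_iff filterlim_split_at flat_def)
  next
    case 3
    have "((\<lambda>t. poly q (1 / t) * exp (- (1 / t))) has_real_derivative flat ?q' t) (at t)"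
      using 3 by (auto intro!: derivative_eq_intros DERIV_chain2[OF poly_DERIV]
          simp: flat_def field_simps power2_eq_square)
    then show ?thesis
      by (rule has_field_derivative_transform_within_open[of _ _ _ "{0<..}"])
        (use 3 in \<open>auto simp: flat_def\<close>)
  qed
qed

lemma smooth_flat: "smooth (flat q)"
proof -
  have "C_k k (flat q)" for k
  proof (induction k arbitrary: q)
    case 0
    show ?case
      using DERIV_isCont[OF flat_has_derivative] by (simp add: continuous_on_eq_continuous_at)
  next
    case (Suc k)
    show ?case
      by (rule C_k_SucI[OF _ C_k_mult[OF Suc.IH C_k_const]])
        (use flat_has_derivative[unfolded has_field_derivative_def] in simp)
  qed
  then show ?thesis by (simp add: smooth_def)
qed

definition step :: "real \<Rightarrow> real" where
  "step t = flat [:1:] t * inverse (flat [:1:] t + flat [:1:] (1 - t))"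

lemma step_denominator: "flat [:1:] t + flat [:1:] (1 - t) > 0"
  by (auto simp: flat_def add_pos_pos)

lemma smooth_step: "smooth step"
proof -
  have "smooth (\<lambda>t. flat [:1:] (1 - t))"
    using smooth_compose_real[OF smooth_flat smooth_diff[OF smooth_const smooth_ident]] .
  then have "smooth (\<lambda>t. flat [:1:] t * inverse (flat [:1:] t + flat [:1:] (1 - t)))"
    using step_denominator
    by (intro smooth_mult smooth_inverse smooth_add smooth_flat) (metis less_irrefl)
  then show ?thesis
    by (simp add: step_def [abs_def])
qed

lemma step_le_0: "t \<le> 0 \<Longrightarrow> step t = 0"
  and step_ge_1: "t \<ge> 1 \<Longrightarrow> step t = 1"
  by (auto simp: step_def flat_def)

lemma step_mono: assumes "s \<le> t" shows "step s \<le> step t"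
proof -
  have g: "0 \<le> flat [:1:] s" "flat [:1:] s \<le> flat [:1:] t" if "s \<le> t" for s t
    using that by (auto simp: flat_def frac_le)
  have "flat [:1:] s * flat [:1:] (1 - t) \<le> flat [:1:] t * flat [:1:] (1 - s)"
    using assms by (intro mult_mono g order_refl) auto
  then show ?thesis
    using step_denominator[of s] step_denominator[of t]
    by (simp add: step_def divide_inverse[symmetric] frac_le_eq divide_simps algebra_simps)
qed

lemma step_bounds: "0 \<le> step t" "step t \<le> 1"
  using step_mono[of "min t 0" t] step_mono[of t "max t 1"] by (auto simp: step_le_0 step_ge_1)

text \<open>The bounds by \<open>\<kappa>\<^sup>r\<close> are used with \<open>r = 1/p\<close>: they let a derivative of the cutoff, multiplied by
  \<open>|u|\<close>, be absorbed by \<open>|u|\<^sup>p \<kappa>\<close>.\<close>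

locale cutoff =
  fixes \<kappa> :: "real \<Rightarrow> real" and C r :: real
  assumes smooth: "smooth \<kappa>"
    and one: "\<And>s. s \<le> 1 \<Longrightarrow> \<kappa> s = 1" and zero: "\<And>s. 2 \<le> s \<Longrightarrow> \<kappa> s = 0"
    and antimono: "\<And>s t. s \<le> t \<Longrightarrow> \<kappa> t \<le> \<kappa> s"
    and bound1: "\<And>s. \<bar>dir_deriv 1 \<kappa> s\<bar> \<le> C * \<kappa> s powr r"
    and bound2: "\<And>s. \<bar>dir_deriv 1 (dir_deriv 1 \<kappa>) s\<bar> \<le> C * \<kappa> s powr r"

text \<open>A high power \<open>T\<^sup>M\<^sup>+\<^sup>2\<close> of a smooth step is such a cutoff: two derivatives lower the exponent
  to \<open>M\<close>, and \<open>T\<^sup>M \<le> T\<^sup>(\<^sup>M\<^sup>+\<^sup>2\<^sup>)\<^sup>r\<close> as soon as \<open>M \<ge> (M + 2) r\<close>, because \<open>0 \<le> T \<le> 1\<close>.\<close>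

lemma cutoff_exists:
  fixes r :: real
  assumes "0 < r" "r < 1"
  obtains \<kappa> C where "cutoff \<kappa> C r"
proof -
  obtain M :: nat where M: "2 * r / (1 - r) < real M" using reals_Archimedean2 by blast
  moreover have "2 * r / (1 - r) > 0" using assms by simp
  ultimately have "M > 0" by (metis of_nat_0 gr0I order_less_asym)
  from M assms have Mr: "(real M + 2) * r \<le> real M"
    by (simp add: field_simps)
  define T where "T = (\<lambda>s::real. step (2 - s))"
  define T1 where "T1 = dir_deriv 1 T"
  define T2 where "T2 = dir_deriv 1 T1"
  have sm: "smooth T" "smooth T1" "smooth T2"
    unfolding T2_def T1_def T_def
    using smooth_compose_real[OF smooth_step smooth_diff[OF smooth_const smooth_ident]]
    by (simp_all add: smooth_dir_deriv)
  have dT: "(T has_real_derivative T1 s) (at s)" "(T1 has_real_derivative T2 s) (at s)" for s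
    unfolding T2_def T1_def using sm by (simp_all add: smooth_has_real_derivative T1_def)
  have Tb: "0 \<le> T s" "T s \<le> 1" for s by (auto simp: T_def step_bounds)
  have dTpow: "((\<lambda>s. T s ^ Suc n) has_real_derivative (1 + real n) * (T1 s * T s ^ n)) (at s)" for n s
    using DERIV_power_Suc[OF dT(1), of n s] by simp
  have T0: "T1 s = 0" "T2 s = 0" if "s \<le> 1" for s
  proof -
    have *: "T1 s = 0" if "s \<le> 1" for s
      unfolding T1_def by (rule smooth_deriv_zero_left[OF sm(1) _ that, of 1])
        (simp add: T_def step_ge_1)
    then show "T1 s = 0" using that by blast
    show "T2 s = 0"
      unfolding T2_def by (rule smooth_deriv_zero_left[OF sm(2) _ that, of 0]) (simp add: *)
  qed
  obtain B where B: "\<And>s. s \<in> {1..2} \<Longrightarrow> \<bar>T1 s\<bar> \<le> B \<and> \<bar>T2 s\<bar> \<le> B" and "B \<ge> 0"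
  proof -
    have "bounded (T1 ` {1..2})" "bounded (T2 ` {1..2})"
      using sm by (auto intro!: compact_imp_bounded compact_continuous_image
          continuous_on_subset[OF smooth_continuous])
    then obtain b c where "\<forall>s\<in>{1..2}. \<bar>T1 s\<bar> \<le> b" "\<forall>s\<in>{1..2}. \<bar>T2 s\<bar> \<le> c"
      by (auto simp: bounded_iff)
    then have "\<forall>s\<in>{1..2}. \<bar>T1 s\<bar> \<le> max 0 (max b c) \<and> \<bar>T2 s\<bar> \<le> max 0 (max b c)" by force
    then show ?thesis by (intro that[of "max 0 (max b c)"]) auto
  qed
  define \<kappa> where "\<kappa> = (\<lambda>s. T s ^ (M + 2))"
  have d1: "dir_deriv 1 \<kappa> = (\<lambda>s. (real M + 2) * T s ^ (M + 1) * T1 s)"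
  proof
    fix s
    have "(\<kappa> has_real_derivative (real M + 2) * T s ^ (M + 1) * T1 s) (at s)"
      using dTpow[of "M + 1" s] by (simp add: \<kappa>_def algebra_simps)
    then show "dir_deriv 1 \<kappa> s = (real M + 2) * T s ^ (M + 1) * T1 s"
      unfolding has_field_derivative_def by (simp add: dir_deriv_eqI)
  qed
  have d2: "dir_deriv 1 (dir_deriv 1 \<kappa>) s =
      (real M + 2) * T s ^ M * ((real M + 1) * T1 s ^ 2 + T s * T2 s)" for s
  proof -
    have "(dir_deriv 1 \<kappa> has_real_derivative
        (real M + 2) * T s ^ M * ((real M + 1) * T1 s ^ 2 + T s * T2 s)) (at s)"
      using DERIV_cmult[OF DERIV_mult[OF dTpow[of M s] dT(2)], of "real M + 2"]
      unfolding d1 by (simp add: algebra_simps power2_eq_square)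
    then show ?thesis
      unfolding has_field_derivative_def by (simp add: dir_deriv_eqI)
  qed
  have pw: "T s ^ M \<le> \<kappa> s powr r" for s
  proof (cases "T s = 0")
    case False
    then have "T s > 0" using Tb(1)[of s] by simp
    have "T s ^ M = T s powr real M" using \<open>T s > 0\<close> by (simp add: powr_realpow)
    also have "\<dots> \<le> T s powr ((real M + 2) * r)"
      using powr_mono'[OF Mr] Tb \<open>T s > 0\<close> by blast
    also have "\<dots> = \<kappa> s powr r"
      using \<open>T s > 0\<close> powr_realpow[of "T s" "M + 2"] by (simp add: \<kappa>_def powr_powr[symmetric] add.commute)
    finally show ?thesis .
  qed (use \<open>M > 0\<close> in \<open>simp add: zero_power\<close>)
  define C where "C = (real M + 2) * ((real M + 1) * B ^ 2 + B)"
  show ?thesis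
  proof (rule that[of \<kappa> C], unfold_locales)
    show "smooth \<kappa>" unfolding \<kappa>_def by (rule smooth_power[OF sm(1)])
    show "\<kappa> s = 1" if "s \<le> 1" for s using that by (simp add: \<kappa>_def T_def step_ge_1)
    show "\<kappa> s = 0" if "2 \<le> s" for s using that by (simp add: \<kappa>_def T_def step_le_0)
    show "\<kappa> t \<le> \<kappa> s" if "s \<le> t" for s t
      using that unfolding \<kappa>_def T_def by (intro power_mono step_mono step_bounds) simp
    have "\<bar>dir_deriv 1 \<kappa> s\<bar> \<le> C * \<kappa> s powr r \<and> \<bar>dir_deriv 1 (dir_deriv 1 \<kappa>) s\<bar> \<le> C * \<kappa> s powr r" for s
    proof (cases "s \<in> {1..2}")
      case True
      note b = B[OF True]
      have "T s * \<bar>T1 s\<bar> \<le> 1 * B" "T s * \<bar>T2 s\<bar> \<le> 1 * B"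
        using b by (intro mult_mono Tb; simp)+
      moreover have "T1 s ^ 2 \<le> B ^ 2"
        using b by (metis abs_ge_zero power2_abs power_mono)
      ultimately have *: "T s * \<bar>T1 s\<bar> \<le> B" "T s * \<bar>T2 s\<bar> \<le> B"
          "(real M + 1) * T1 s ^ 2 \<le> (real M + 1) * B ^ 2"
        by (simp_all add: mult_left_mono)
      have "0 \<le> (real M + 1) * T1 s ^ 2" "0 \<le> (real M + 1) * B ^ 2"
        "\<bar>T s * T2 s\<bar> = T s * \<bar>T2 s\<bar>"
        using Tb(1)[of s] by (simp_all add: abs_mult)
      with * have "T s * \<bar>T1 s\<bar> \<le> (real M + 1) * B ^ 2 + B"
        and "\<bar>(real M + 1) * T1 s ^ 2 + T s * T2 s\<bar> \<le> (real M + 1) * B ^ 2 + B"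
        by linarith+
      then have "T s ^ M * (T s * \<bar>T1 s\<bar>) \<le> \<kappa> s powr r * ((real M + 1) * B ^ 2 + B)"
        "T s ^ M * \<bar>(real M + 1) * T1 s ^ 2 + T s * T2 s\<bar> \<le> \<kappa> s powr r * ((real M + 1) * B ^ 2 + B)"
        using pw Tb(1)[of s] by (auto intro!: mult_mono)
      then have "(real M + 2) * (T s ^ M * (T s * \<bar>T1 s\<bar>)) \<le> (real M + 2) * (\<kappa> s powr r * ((real M + 1) * B ^ 2 + B))"
        "(real M + 2) * (T s ^ M * \<bar>(real M + 1) * T1 s ^ 2 + T s * T2 s\<bar>) \<le> (real M + 2) * (\<kappa> s powr r * ((real M + 1) * B ^ 2 + B))"
        by (auto intro!: mult_left_mono)
      then show ?thesis
        unfolding d2 unfolding d1 C_def using Tb(1)[of s] by (simp add: abs_mult power_abs mult_ac)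
    next
      case False
      then have "T1 s = 0 \<and> T2 s = 0 \<or> T s = 0" using T0 by (auto simp: T_def step_le_0)
      then show ?thesis
        unfolding d2 unfolding d1 C_def using \<open>M > 0\<close> \<open>B \<ge> 0\<close> by (auto simp: zero_power)
    qed
    then show "\<bar>dir_deriv 1 \<kappa> s\<bar> \<le> C * \<kappa> s powr r"
      "\<bar>dir_deriv 1 (dir_deriv 1 \<kappa>) s\<bar> \<le> C * \<kappa> s powr r" for s by auto
  qed
qed

context cutoff
begin

definition \<kappa>1 :: "real \<Rightarrow> real" where "\<kappa>1 = dir_deriv 1 \<kappa>"
definition \<kappa>2 :: "real \<Rightarrow> real" where "\<kappa>2 = dir_deriv 1 \<kappa>1"

lemma smooth12: "smooth \<kappa>1" "smooth \<kappa>2"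
  using smooth by (simp_all add: \<kappa>1_def \<kappa>2_def smooth_dir_deriv)

lemma DERIV_\<kappa>:
  "(\<kappa> has_real_derivative \<kappa>1 s) (at s)" "(\<kappa>1 has_real_derivative \<kappa>2 s) (at s)"
  using smooth smooth12 by (simp_all add: \<kappa>1_def \<kappa>2_def smooth_has_real_derivative)

lemma bounds12: "\<bar>\<kappa>1 s\<bar> \<le> C * \<kappa> s powr r" "\<bar>\<kappa>2 s\<bar> \<le> C * \<kappa> s powr r"
  using bound1 bound2 by (simp_all add: \<kappa>1_def \<kappa>2_def)

lemma C_nonneg: "0 \<le> C"
  using bounds12(1)[of 1] by (simp add: one)

lemma bounds: "0 \<le> \<kappa> s" "\<kappa> s \<le> 1"
  using antimono[of s "max s 2"] antimono[of "min s 1" s] by (simp_all add: one zero)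

lemma vanish_left: "s \<le> 1 \<Longrightarrow> \<kappa>1 s = 0" "s \<le> 1 \<Longrightarrow> \<kappa>2 s = 0"
proof -
  show *: "s \<le> 1 \<Longrightarrow> \<kappa>1 s = 0" for s
    unfolding \<kappa>1_def by (rule smooth_deriv_zero_left[OF smooth, of 1 1]) (auto simp: one)
  show "s \<le> 1 \<Longrightarrow> \<kappa>2 s = 0"
    unfolding \<kappa>2_def by (rule smooth_deriv_zero_left[OF smooth12(1), of 1 0]) (auto simp: *)
qed

lemma vanish_right: "2 \<le> s \<Longrightarrow> \<kappa>1 s = 0" "2 \<le> s \<Longrightarrow> \<kappa>2 s = 0"
  using bounds12[of s] by (simp_all add: zero)

lemma \<kappa>1_nonpos: "\<kappa>1 s \<le> 0"
proof (rule ccontr)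
  assume "\<not> \<kappa>1 s \<le> 0"
  then obtain d where "d > 0" "\<And>h. h > 0 \<Longrightarrow> h < d \<Longrightarrow> \<kappa> s < \<kappa> (s + h)"
    using DERIV_pos_inc_right[OF DERIV_\<kappa>(1), of s] by auto
  then have "\<kappa> s < \<kappa> (s + d / 2)" by simp
  with antimono[of s "s + d / 2"] \<open>d > 0\<close> show False by simp
qed

lemma DERIV_rescaled:
  shows "((\<lambda>t. \<kappa> (t / c)) has_real_derivative \<kappa>1 (t / c) / c) (at t within S)"
    and "((\<lambda>t. \<kappa>1 (t / c)) has_real_derivative \<kappa>2 (t / c) / c) (at t within S)"
proof -
  have "((\<lambda>t. t / c) has_real_derivative 1 / c) (at t within S)"
    by (rule DERIV_cdivide[OF DERIV_ident])
  from DERIV_chain2[OF DERIV_\<kappa>(1) this] DERIV_chain2[OF DERIV_\<kappa>(2) this]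
  show "((\<lambda>t. \<kappa> (t / c)) has_real_derivative \<kappa>1 (t / c) / c) (at t within S)"
    "((\<lambda>t. \<kappa>1 (t / c)) has_real_derivative \<kappa>2 (t / c) / c) (at t within S)"
    by simp_all
qed

lemma continuous_on_rescaled:
  "continuous_on S (\<lambda>t. \<kappa> (t / c))" "continuous_on S (\<lambda>t. \<kappa>1 (t / c))"
  "continuous_on S (\<lambda>t. \<kappa>2 (t / c))"
proof -
  have "continuous_on S (\<lambda>t::real. t / c)"
    unfolding divide_inverse by (intro continuous_intros)
  then show "continuous_on S (\<lambda>t. \<kappa> (t / c))" "continuous_on S (\<lambda>t. \<kappa>1 (t / c))"
    "continuous_on S (\<lambda>t. \<kappa>2 (t / c))"
    by (rule continuous_on_compose2[OF smooth_continuous, rotated]; simp add: smooth smooth12)+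
qed

end

section \<open>Pairings with square integrable functions\<close>

definition pairing :: "('a::euclidean_space \<Rightarrow> real) \<Rightarrow> ('a \<Rightarrow> real) \<Rightarrow> real" where
  "pairing f g = (LINT x|lebesgue. f x * g x)"

lemma in_L2_integrable_mult:
  assumes "in_L2 f" "in_L2 g"
  shows "integrable lebesgue (\<lambda>x. f x * g x)"
proof (rule Bochner_Integration.integrable_bound)
  show "integrable lebesgue (\<lambda>x. (f x)\<^sup>2 + (g x)\<^sup>2)"
    using assms by (auto simp: in_L2_def)
  show "(\<lambda>x. f x * g x) \<in> borel_measurable lebesgue"
    using assms by (auto simp: in_L2_def)
  have "\<bar>a * b\<bar> \<le> a\<^sup>2 + b\<^sup>2" for a b :: real
  proof -
    have "\<bar>a * b\<bar> \<le> 2 * \<bar>a\<bar> * \<bar>b\<bar>" by (simp add: abs_mult)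
    also have "\<dots> \<le> a\<^sup>2 + b\<^sup>2" using sum_squares_bound[of "\<bar>a\<bar>" "\<bar>b\<bar>"] by simp
    finally show ?thesis .
  qed
  then show "AE x in lebesgue. norm (f x * g x) \<le> norm ((f x)\<^sup>2 + (g x)\<^sup>2)"
    by auto
qed

lemma in_L2_diff: "in_L2 f \<Longrightarrow> in_L2 g \<Longrightarrow> in_L2 (\<lambda>x. f x - g x)"
proof -
  assume *: "in_L2 f" "in_L2 g"
  then have "integrable lebesgue (\<lambda>x. (f x)\<^sup>2 - 2 * (f x * g x) + (g x)\<^sup>2)"
    using in_L2_integrable_mult[OF *] by (auto simp: in_L2_def)
  with * show ?thesis
    by (auto simp: in_L2_def power2_diff algebra_simps)
qed

lemma in_L2_divide: "in_L2 f \<Longrightarrow> in_L2 (\<lambda>x. f x / c)"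
  by (auto simp: in_L2_def power_divide)

text \<open>The quadratic polynomial \<open>c \<mapsto> \<integral> (f - c g)\<^sup>2\<close> is nonnegative; its value at the minimum
  \<open>c = \<integral> f g / \<integral> g\<^sup>2\<close> is the claim, and it could not be affine and nonconstant if \<open>\<integral> g\<^sup>2 = 0\<close>.\<close>

lemma Cauchy_Schwarz_pairing:
  assumes "in_L2 f" "in_L2 g"
  shows "\<bar>pairing f g\<bar> \<le> L2_norm f * L2_norm g"
proof -
  define F where "F = (LINT x|lebesgue. (f x)\<^sup>2)"
  define G where "G = (LINT x|lebesgue. (g x)\<^sup>2)"
  define b where "b = pairing f g"
  note F_G_b_def = F_def G_def b_def
  have nn: "0 \<le> F" "0 \<le> G" by (auto simp: F_G_b_def)
  have quad: "0 \<le> F - 2 * c * b + c\<^sup>2 * G" for c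
  proof -
    have "0 \<le> (LINT x|lebesgue. (f x - c * g x)\<^sup>2)" by simp
    also have "\<dots> = (LINT x|lebesgue. (f x)\<^sup>2 - 2 * c * (f x * g x) + c\<^sup>2 * (g x)\<^sup>2)"
      by (simp add: power2_diff power_mult_distrib algebra_simps)
    also have "\<dots> = F - 2 * c * b + c\<^sup>2 * G"
      using assms in_L2_integrable_mult[OF assms] by (simp add: in_L2_def F_G_b_def pairing_def)
    finally show ?thesis .
  qed
  have "b\<^sup>2 \<le> F * G"
  proof (cases "G = 0")
    case True
    have "b = 0"
      using quad[of "(F + 1) / (2 * b)"] True by (cases "b = 0") auto
    then show ?thesis using nn by simp
  next
    case False
    with nn have "G > 0" by simp
    then show ?thesis
      using quad[of "b / G"] by (simp add: field_simps power2_eq_square)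
  qed
  then have "\<bar>b\<bar> \<le> sqrt (F * G)" by (simp add: real_le_rsqrt)
  then show ?thesis
    by (simp add: F_G_b_def L2_norm_def real_sqrt_mult)
qed

lemma pairing_diff_left:
  assumes "in_L2 f" "in_L2 h" "in_L2 g"
  shows "pairing (\<lambda>x. f x - h x) g = pairing f g - pairing h g"
  using assms by (simp add: pairing_def left_diff_distrib in_L2_integrable_mult)

lemma continuous_on_pairing:
  assumes "continuous_L2 v" "in_L2 g"
  shows "continuous_on {0..} (\<lambda>t. pairing (v t) g)"
  unfolding continuous_on_def
proof
  fix t :: real assume "t \<in> {0..}"
  then have t: "t \<ge> 0" by simp
  have v: "in_L2 (v s)" if "s \<ge> 0" for s using assms(1) that by (auto simp: continuous_L2_def)
  have "((\<lambda>s. pairing (v s) g - pairing (v t) g) \<longlongrightarrow> 0) (at t within {0..})"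
  proof (rule Lim_null_comparison)
    show "\<forall>\<^sub>F s in at t within {0..}. norm (pairing (v s) g - pairing (v t) g)
        \<le> L2_norm (\<lambda>x. v s x - v t x) * L2_norm g"
      unfolding eventually_at_filter
      using Cauchy_Schwarz_pairing[OF in_L2_diff[OF v v[OF t]] assms(2)]
      by (intro always_eventually) (auto simp: pairing_diff_left[OF v v[OF t] assms(2)])
    show "((\<lambda>s. L2_norm (\<lambda>x. v s x - v t x) * L2_norm g) \<longlongrightarrow> 0) (at t within {0..})"
      using assms(1) t by (intro tendsto_mult_left_zero) (auto simp: continuous_L2_def)
  qed
  then show "((\<lambda>s. pairing (v s) g) \<longlongrightarrow> pairing (v t) g) (at t within {0..})"
    by (rule LIM_zero_cancel)
qed

text \<open>Differentiability in \<open>L\<^sup>2\<close> is used only after pairing with fixed functions of \<open>x\<close>; this turns the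
  equation into statements about real functions of \<open>t\<close>.\<close>

lemma pairing_has_derivative:
  assumes u: "\<And>t. t \<ge> 0 \<Longrightarrow> in_L2 (u t)" and v: "\<And>t. t \<ge> 0 \<Longrightarrow> in_L2 (v t)"
    and "has_L2_time_deriv u v" "in_L2 g" and t: "t \<ge> 0"
  shows "((\<lambda>s. pairing (u s) g) has_real_derivative pairing (v t) g) (at t within {0..})"
proof -
  let ?q = "\<lambda>s x. (u s x - u t x) / (s - t) - v t x"
  have "((\<lambda>s. (pairing (u s) g - pairing (u t) g) / (s - t) - pairing (v t) g) \<longlongrightarrow> 0) (at t within {0..})"
  proof (rule Lim_null_comparison)
    have "\<bar>(pairing (u s) g - pairing (u t) g) / (s - t) - pairing (v t) g\<bar> \<le> L2_norm (?q s) * L2_norm g"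
      if s: "s \<ge> 0" for s
    proof -
      have "pairing (\<lambda>x. (u s x - u t x) / (s - t)) g = pairing (\<lambda>x. u s x - u t x) g / (s - t)"
        by (simp add: pairing_def)
      then have "pairing (?q s) g = (pairing (u s) g - pairing (u t) g) / (s - t) - pairing (v t) g"
        using u[OF s] u[OF t] v[OF t] assms(4)
        by (simp add: pairing_diff_left in_L2_diff in_L2_divide)
      then show ?thesis
        using Cauchy_Schwarz_pairing[OF in_L2_diff[OF in_L2_divide[OF in_L2_diff[OF u[OF s] u[OF t]]] v[OF t]] assms(4), of "s - t"]
        by simp
    qed
    then show "\<forall>\<^sub>F s in at t within {0..}. norm ((pairing (u s) g - pairing (u t) g) / (s - t)
        - pairing (v t) g) \<le> L2_norm (?q s) * L2_norm g"
      unfolding eventually_at_filter by (intro always_eventually) auto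
    show "((\<lambda>s. L2_norm (?q s) * L2_norm g) \<longlongrightarrow> 0) (at t within {0..})"
      using assms(3) t by (intro tendsto_mult_left_zero) (auto simp: has_L2_time_deriv_def)
  qed
  then show ?thesis
    unfolding has_field_derivative_iff by (rule LIM_zero_cancel)
qed

lemma integrable_continuous_compact_support:
  fixes g :: "'a::euclidean_space \<Rightarrow> real"
  assumes "continuous_on UNIV g" "\<And>x. norm x > r \<Longrightarrow> g x = 0"
  shows "integrable lebesgue g"
proof -
  obtain a b where ab: "cball (0::'a) r \<subseteq> cbox a b"
    using bounded_subset_cbox_symmetric[OF bounded_cball] by metis
  have "set_integrable lebesgue (cbox a b) g"
    by (rule absolutely_integrable_continuous) (rule continuous_on_subset[OF assms(1)], simp)
  moreover have "(\<lambda>x. indicat_real (cbox a b) x *\<^sub>R g x) = g"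
    using assms(2) ab by (auto simp: fun_eq_iff indicator_def subset_iff) (meson not_le)
  ultimately show ?thesis
    by (simp add: set_integrable_def)
qed

lemma in_L2_continuous_compact_support:
  fixes g :: "'a::euclidean_space \<Rightarrow> real"
  assumes "continuous_on UNIV g" "\<And>x. norm x > r \<Longrightarrow> g x = 0"
  shows "in_L2 g"
  unfolding in_L2_def
proof
  show "g \<in> borel_measurable lebesgue"
    using integrable_continuous_compact_support[OF assms] by (rule borel_measurable_integrable)
  show "integrable lebesgue (\<lambda>x. (g x)\<^sup>2)"
    by (rule integrable_continuous_compact_support[of _ r]) (use assms in \<open>auto intro!: continuous_intros\<close>)
qed

section \<open>The boundary term\<close>

lemma set_integrable_half_line:
  fixes h :: "real \<Rightarrow> real"
  assumes "continuous_on {0..} h" "\<And>t. t > c \<Longrightarrow> h t = 0"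
  shows "set_integrable lebesgue {0<..} h"
proof -
  have "set_integrable lebesgue {0..c} h"
    by (rule absolutely_integrable_continuous_real) (rule continuous_on_subset[OF assms(1)], auto)
  then have "set_integrable lebesgue {0<..c} h"
    by (rule set_integrable_subset) auto
  moreover have "(\<lambda>t. indicat_real {0<..c} t *\<^sub>R h t) = (\<lambda>t. indicat_real {0<..} t *\<^sub>R h t)"
    using assms(2) by (force simp: indicator_def fun_eq_iff)
  ultimately show ?thesis
    by (simp add: set_integrable_def)
qed

context cutoff
begin

text \<open>The operator \<open>(1 + t) \<partial>\<^sub>t\<^sup>2 + (2 - \<mu>) \<partial>\<^sub>t\<close> applied to \<open>\<kappa>(t / \<rho>)\<close>. It is the time part of the adjoint
  equation for test functions with the factor \<open>1 + t\<close>.\<close>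

definition time_weight :: "real \<Rightarrow> real \<Rightarrow> real \<Rightarrow> real" where
  "time_weight \<mu> \<rho> t = (1 + t) * \<kappa>2 (t / \<rho>) / \<rho>\<^sup>2 + (2 - \<mu>) * \<kappa>1 (t / \<rho>) / \<rho>"

text \<open>With \<open>k(t) = \<kappa>(t / \<epsilon>)\<close> one has
  \<open>((1 + t) k'' + (2 - \<mu>) k') m = ((1 + t) k' m)' - k' ((1 + t) m' + (\<mu> - 1) m)\<close>.
  The first term integrates to zero, since \<open>k'\<close> vanishes outside \<open>[\<epsilon>, 2 \<epsilon>]\<close>, and \<open>- k'\<close> is a
  probability density there. So the integral averages \<open>(1 + t) m' + (\<mu> - 1) m\<close> near \<open>t = 0\<close>, where
  it is close to its initial value.\<close>

lemma boundary_term_ge: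
  fixes m m' :: "real \<Rightarrow> real"
  assumes "\<epsilon> > 0"
    and m: "\<And>t. t \<ge> 0 \<Longrightarrow> (m has_real_derivative m' t) (at t within {0..})"
    and m': "continuous_on {0..} m'"
    and ge: "\<And>t. 0 \<le> t \<Longrightarrow> t \<le> 2 * \<epsilon> \<Longrightarrow> c \<le> (1 + t) * m' t + (\<mu> - 1) * m t"
  shows "c \<le> (LINT t:{0<..}|lebesgue. time_weight \<mu> \<epsilon> t * m t)"
proof -
  let ?E = "time_weight \<mu> \<epsilon>"
  (* The primitive is corrected by the constant multiple c of the cutoff, so that it gains exactly c. *)
  define G where "G = (\<lambda>t. (1 + t) * \<kappa>1 (t / \<epsilon>) * m t / \<epsilon> - c * \<kappa> (t / \<epsilon>))"
  define G' where "G' = (\<lambda>t. ((1 + t) * \<kappa>2 (t / \<epsilon>) / \<epsilon>\<^sup>2 + \<kappa>1 (t / \<epsilon>) / \<epsilon>) * m t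
      + (1 + t) * \<kappa>1 (t / \<epsilon>) / \<epsilon> * m' t - c * \<kappa>1 (t / \<epsilon>) / \<epsilon>)"
  have G: "(G has_real_derivative G' t) (at t within {0..})" if "t \<ge> 0" for t
  proof -
    have "((\<lambda>t. 1 + t) has_real_derivative 1) (at t within {0..})"
      by (auto intro!: derivative_eq_intros)
    from DERIV_diff[OF DERIV_cdivide[OF DERIV_mult[OF DERIV_mult[OF this DERIV_rescaled(2)] m[OF that]]]
        DERIV_cmult[OF DERIV_rescaled(1)], of \<epsilon> \<epsilon> c \<epsilon>]
    show ?thesis
      unfolding G_def G'_def
      by (rule DERIV_cong) (use \<open>\<epsilon> > 0\<close> in \<open>simp add: field_simps power2_eq_square\<close>)
  qed
  have int: "(G' has_integral G (2 * \<epsilon>) - G 0) {0..2 * \<epsilon>}"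
  proof (rule fundamental_theorem_of_calculus)
    fix t assume "t \<in> {0..2 * \<epsilon>}"
    then show "(G has_vector_derivative G' t) (at t within {0..2 * \<epsilon>})"
      using DERIV_subset[OF G[of t], of "{0..2 * \<epsilon>}"]
      by (auto simp: has_real_derivative_iff_has_vector_derivative)
  qed (use \<open>\<epsilon> > 0\<close> in simp)
  have G_end: "G (2 * \<epsilon>) - G 0 = c"
    using \<open>\<epsilon> > 0\<close> by (simp add: G_def one zero vanish_left vanish_right)
  have m_cont: "continuous_on {0..} m"
    using m by (auto simp: continuous_on_eq_continuous_within intro!: DERIV_continuous)
  have Em_cont: "continuous_on {0..} (\<lambda>t. ?E t * m t)"
    unfolding time_weight_def using \<open>\<epsilon> > 0\<close> by (auto intro!: continuous_intros continuous_on_rescaled m_cont)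
  have Em0: "?E t * m t = 0" if "t > 2 * \<epsilon> \<or> t = 0" for t
    using that \<open>\<epsilon> > 0\<close> by (auto simp: time_weight_def vanish_left vanish_right field_simps)
  have "c = integral {0..2 * \<epsilon>} G'"
    using integral_unique[OF int] G_end by simp
  also have "\<dots> \<le> integral {0..2 * \<epsilon>} (\<lambda>t. ?E t * m t)"
  proof (rule integral_le)
    show "G' integrable_on {0..2 * \<epsilon>}" using int by blast
    show "(\<lambda>t. ?E t * m t) integrable_on {0..2 * \<epsilon>}"
      by (rule integrable_continuous_real) (rule continuous_on_subset[OF Em_cont], auto)
    fix t assume "t \<in> {0..2 * \<epsilon>}"
    then have "0 \<le> (- \<kappa>1 (t / \<epsilon>) / \<epsilon>) * ((1 + t) * m' t + (\<mu> - 1) * m t - c)"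
      using \<kappa>1_nonpos[of "t / \<epsilon>"] ge[of t] \<open>\<epsilon> > 0\<close> by (intro mult_nonneg_nonneg) (auto intro: divide_nonpos_pos)
    also have "\<dots> = ?E t * m t - G' t"
      using \<open>\<epsilon> > 0\<close> by (simp add: time_weight_def G'_def field_simps power2_eq_square)
    finally show "G' t \<le> ?E t * m t" by simp
  qed
  also have "\<dots> = (LINT t:{0..2 * \<epsilon>}|lebesgue. ?E t * m t)"
    by (rule set_lebesgue_integral_eq_integral(2)[symmetric])
      (rule absolutely_integrable_continuous_real, rule continuous_on_subset[OF Em_cont], auto)
  also have "\<dots> = (LINT t:{0<..}|lebesgue. ?E t * m t)"
  proof -
    have "indicat_real {0..2 * \<epsilon>} t *\<^sub>R (?E t * m t) = indicat_real {0<..} t *\<^sub>R (?E t * m t)" for t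
      by (cases "t > 2 * \<epsilon> \<or> t = 0") (use Em0[of t] in \<open>auto simp: indicator_def\<close>)
    then show ?thesis by (simp only: set_lebesgue_integral_def)
  qed
  finally show ?thesis .
qed

end

section \<open>The test functions\<close>

lemma dir_deriv_tensor:
  fixes g :: "'a::euclidean_space \<Rightarrow> real"
  assumes a: "(a has_real_derivative a') (at t)" and g: "g differentiable (at x)"
  shows "dir_deriv (\<tau>, h) (\<lambda>z. a (fst z) * g (snd z)) (t, x) = \<tau> * a' * g x + a t * dir_deriv h g x"
proof -
  have A: "((\<lambda>z. a (fst z)) has_derivative (\<lambda>v. a' * fst v)) (at (t, x))"
    using has_derivative_compose[OF has_derivative_fst[OF has_derivative_ident], of a "(*) a'" "(t, x)" UNIV] a
    by (simp add: has_field_derivative_def)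
  have B: "((\<lambda>z. g (snd z)) has_derivative (\<lambda>v. dir_deriv (snd v) g x)) (at (t, x))"
    using has_derivative_compose[OF has_derivative_snd[OF has_derivative_ident], of g "\<lambda>h. dir_deriv h g x" "(t, x)" UNIV] g
    by (simp add: frechet_derivative_works dir_deriv_def)
  have "((\<lambda>z. a (fst z) * g (snd z)) has_derivative
      (\<lambda>v. a t * dir_deriv (snd v) g x + a' * fst v * g x)) (at (t, x))"
    using has_derivative_mult[OF A B] by simp
  then show ?thesis
    by (simp add: dir_deriv_eqI)
qed

lemma smooth_differentiable: "smooth f \<Longrightarrow> f differentiable (at x)"
  unfolding smooth_def using C_k.simps(2) by blast

context cutoff
begin

definition bump :: "real \<Rightarrow> 'a::euclidean_space \<Rightarrow> real" where
  "bump R x = \<kappa> ((norm x)\<^sup>2 / R\<^sup>2)"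

definition bump_laplacian :: "real \<Rightarrow> 'a::euclidean_space \<Rightarrow> real" where
  "bump_laplacian R x = (\<Sum>b\<in>Basis. dir_deriv b (dir_deriv b (bump R)) x)"

lemma smooth_bump: "smooth (bump R :: 'a::euclidean_space \<Rightarrow> real)"
proof -
  have "smooth (\<lambda>x::'a. (norm x)\<^sup>2 * inverse (R\<^sup>2))"
    by (rule smooth_mult[OF smooth_norm_square smooth_const])
  from smooth_compose_real[OF smooth this] show ?thesis
    by (simp add: bump_def [abs_def] divide_inverse)
qed

lemma bump_bounds: "0 \<le> bump R x" "bump R x \<le> 1"
  by (simp_all add: bump_def bounds)

lemma bump_eq_1: "R > 0 \<Longrightarrow> norm x \<le> R \<Longrightarrow> bump R x = 1"
  unfolding bump_def by (rule one) (simp add: power_mono)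

lemma two_le_norm_ratio: "R > 0 \<Longrightarrow> norm x \<ge> 2 * R \<Longrightarrow> 2 \<le> (norm x)\<^sup>2 / R\<^sup>2"
proof -
  assume *: "R > 0" "norm x \<ge> 2 * R"
  then have "4 * R\<^sup>2 \<le> (norm x)\<^sup>2"
    using power_mono[of "2 * R" "norm x" 2] by (simp add: power_mult_distrib)
  then have "2 * R\<^sup>2 \<le> (norm x)\<^sup>2" using zero_le_power2[of R] by linarith
  with * show ?thesis by (simp add: pos_le_divide_eq)
qed

lemma bump_eq_0: "R > 0 \<Longrightarrow> norm x \<ge> 2 * R \<Longrightarrow> bump R x = 0"
  unfolding bump_def by (rule zero) (rule two_le_norm_ratio)

lemma bump_mono: "0 < R \<Longrightarrow> R \<le> R' \<Longrightarrow> bump R x \<le> bump R' x"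
  unfolding bump_def by (intro antimono divide_left_mono) (auto simp: power_mono)

lemma norm_square_has_derivative:
  "((\<lambda>x::'a::euclidean_space. (norm x)\<^sup>2 / R\<^sup>2) has_derivative (\<lambda>h. 2 * (x \<bullet> h) / R\<^sup>2)) (at x)"
proof -
  have "((\<lambda>x::'a. x \<bullet> x) has_derivative (\<lambda>h. x \<bullet> h + h \<bullet> x)) (at x)"
    by (rule has_derivative_inner[OF has_derivative_ident has_derivative_ident])
  from has_derivative_mult_left[OF this, of "inverse (R\<^sup>2)"] show ?thesis
    by (simp add: power2_norm_eq_inner inner_commute divide_inverse)
qed

lemma bump_laplacian_eq:
  fixes x :: "'a::euclidean_space"
  shows "bump_laplacian R x = \<kappa>2 ((norm x)\<^sup>2 / R\<^sup>2) * (4 * (norm x)\<^sup>2 / R ^ 4)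
    + \<kappa>1 ((norm x)\<^sup>2 / R\<^sup>2) * (2 * real DIM('a) / R\<^sup>2)"
proof -
  have chain: "((\<lambda>x::'a. f ((norm x)\<^sup>2 / R\<^sup>2)) has_derivative (\<lambda>h. f' * (2 * (x \<bullet> h) / R\<^sup>2))) (at x)"
    if "(f has_real_derivative f') (at ((norm x)\<^sup>2 / R\<^sup>2))" for f f' x
    using has_derivative_compose[OF norm_square_has_derivative that[unfolded has_field_derivative_def]] .
  have d1: "dir_deriv b (bump R) = (\<lambda>x::'a. \<kappa>1 ((norm x)\<^sup>2 / R\<^sup>2) * (2 * (x \<bullet> b) / R\<^sup>2))" for b
    unfolding bump_def [abs_def] by (rule ext, rule dir_deriv_eqI[OF chain[OF DERIV_\<kappa>(1)]])
  have "dir_deriv b (dir_deriv b (bump R)) x = \<kappa>2 ((norm x)\<^sup>2 / R\<^sup>2) * (4 * (x \<bullet> b)\<^sup>2 / R ^ 4)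
    + \<kappa>1 ((norm x)\<^sup>2 / R\<^sup>2) * (2 / R\<^sup>2)" if "b \<in> Basis" for b
  proof -
    have "((\<lambda>x. 2 * (x \<bullet> b) / R\<^sup>2) has_derivative (\<lambda>h. 2 * (h \<bullet> b) / R\<^sup>2)) (at x)"
      using has_derivative_mult_right[OF bounded_linear_imp_has_derivative[OF
            bounded_linear_inner_left[of b]], of "2 / R\<^sup>2" "at x"] by simp
    note dir_deriv_eqI[OF has_derivative_mult[OF chain[OF DERIV_\<kappa>(2)] this], of b]
    then show ?thesis
      unfolding d1 using that
      by (simp add: power2_eq_square power4_eq_xxxx divide_inverse mult_ac)
  qed
  moreover have "(\<Sum>b\<in>Basis. (x \<bullet> b)\<^sup>2) = (norm x)\<^sup>2"
    unfolding power2_norm_eq_inner by (subst euclidean_inner) (simp add: power2_eq_square)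
  ultimately show ?thesis
    by (simp add: bump_laplacian_def sum.distrib flip: sum_distrib_left sum_divide_distrib)
qed

lemma bump_laplacian_eq_0:
  assumes "R > 0" and "norm x \<le> R \<or> norm x \<ge> 2 * R"
  shows "bump_laplacian R x = 0"
  using assms(2)
proof
  assume "norm x \<le> R"
  then have "(norm x)\<^sup>2 / R\<^sup>2 \<le> 1" using assms(1) by (simp add: power_mono)
  then show ?thesis by (simp add: bump_laplacian_eq vanish_left)
next
  assume "norm x \<ge> 2 * R"
  then have "(norm x)\<^sup>2 / R\<^sup>2 \<ge> 2"
    by (rule two_le_norm_ratio[OF assms(1)])
  then show ?thesis by (simp add: bump_laplacian_eq vanish_right)
qed

lemma bump_laplacian_bound:
  fixes x :: "'a::euclidean_space"
  assumes "R > 0"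
  shows "\<bar>bump_laplacian R x\<bar> \<le> C * (8 + 2 * real DIM('a)) / R\<^sup>2 * bump R x powr r"
proof -
  let ?s = "(norm x)\<^sup>2 / R\<^sup>2"
  show ?thesis
  proof (cases "?s \<le> 2")
    case True
    have "bump_laplacian R x = (4 * ?s * \<kappa>2 ?s + 2 * real DIM('a) * \<kappa>1 ?s) / R\<^sup>2"
      using assms by (simp add: bump_laplacian_eq field_simps power4_eq_xxxx power2_eq_square)
    moreover have "\<bar>4 * ?s * \<kappa>2 ?s\<bar> \<le> 8 * (C * \<kappa> ?s powr r)"
      unfolding abs_mult using True by (intro mult_mono bounds12) auto
    moreover have "\<bar>2 * real DIM('a) * \<kappa>1 ?s\<bar> \<le> 2 * real DIM('a) * (C * \<kappa> ?s powr r)"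
      unfolding abs_mult by (intro mult_mono bounds12) auto
    ultimately have "\<bar>bump_laplacian R x\<bar> \<le>
        (8 * (C * \<kappa> ?s powr r) + 2 * real DIM('a) * (C * \<kappa> ?s powr r)) / R\<^sup>2"
      by (simp only: abs_divide abs_power2) (rule divide_right_mono, linarith, simp)
    then show ?thesis
      by (simp add: bump_def algebra_simps)
  next
    case False
    then show ?thesis
      using C_nonneg by (simp add: bump_laplacian_eq vanish_right)
  qed
qed

lemma continuous_on_bump_laplacian:
  "continuous_on UNIV (bump_laplacian R :: 'a::euclidean_space \<Rightarrow> real)"
  unfolding bump_laplacian_def [abs_def]
  by (intro continuous_on_sum smooth_continuous smooth_dir_deriv smooth_bump)

text \<open>The window is the outer cutoff minus the inner one. Each of them produces its own copy of the
  time weight in the adjoint equation: the inner copy yields the initial data, the outer one is an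
  error term.\<close>

definition window :: "real \<Rightarrow> real \<Rightarrow> real \<Rightarrow> real" where
  "window \<epsilon> R t = \<kappa> (t / R) - \<kappa> (t / \<epsilon>)"

lemma window_bounds:
  assumes "0 < \<epsilon>" "\<epsilon> \<le> R" "0 \<le> t"
  shows "0 \<le> window \<epsilon> R t" "window \<epsilon> R t \<le> 1"
proof -
  have "\<kappa> (t / \<epsilon>) \<le> \<kappa> (t / R)"
    using assms by (intro antimono divide_left_mono) auto
  then show "0 \<le> window \<epsilon> R t" "window \<epsilon> R t \<le> 1"
    using bounds[of "t / R"] bounds[of "t / \<epsilon>"] by (simp_all add: window_def)
qed

definition wave_test :: "real \<Rightarrow> real \<Rightarrow> real \<times> 'a::euclidean_space \<Rightarrow> real" where
  "wave_test \<epsilon> R z = (1 + fst z) * window \<epsilon> R (fst z) * bump R (snd z)"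

lemma wave_test_is_test_function:
  assumes "0 < \<epsilon>" "\<epsilon> \<le> R"
  shows "test_function ({0<..} \<times> UNIV) (wave_test \<epsilon> R :: real \<times> 'a::euclidean_space \<Rightarrow> real)"
proof -
  have "smooth (\<lambda>t. (1 + t) * window \<epsilon> R t)"
    unfolding window_def divide_inverse mult.commute[of _ "inverse _"]
    by (intro smooth_mult smooth_add smooth_diff smooth_const smooth_ident
        smooth_cmult_arg[OF smooth])
  then have "smooth (wave_test \<epsilon> R :: real \<times> 'a \<Rightarrow> real)"
    unfolding wave_test_def [abs_def] by (rule smooth_mult[OF smooth_fst smooth_snd[OF smooth_bump]])
  moreover have "wave_test \<epsilon> R z = 0" if "z \<notin> {\<epsilon>..2 * R} \<times> cball (0::'a) (2 * R)" for z
  proof -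
    have "window \<epsilon> R t = 0" if "t < \<epsilon> \<or> t > 2 * R" for t
      using that assms by (auto simp: window_def one zero field_simps)
    moreover have "bump R x = 0" if "norm x > 2 * R" for x :: 'a
      using that assms by (intro bump_eq_0) auto
    ultimately show ?thesis
      using that by (cases z) (auto simp: wave_test_def not_le)
  qed
  moreover have "compact ({\<epsilon>..2 * R} \<times> cball (0::'a) (2 * R))"
    by (intro compact_Times) auto
  ultimately show ?thesis
    using assms(1) unfolding test_function_def smooth_def
    by (intro conjI exI[of _ "{\<epsilon>..2 * R} \<times> cball (0::'a) (2 * R)"]) auto
qed

text \<open>For \<open>a(t) = (1 + t) w(t)\<close> the damping term \<open>\<mu> a / (1 + t)\<close> is just \<open>\<mu> w\<close>, so that
  \<open>a'' - (\<mu> a / (1 + t))' = (1 + t) w'' + (2 - \<mu>) w'\<close>. This is why the test function carries the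
  factor \<open>1 + t\<close>.\<close>

lemma wave_test_adjoint:
  fixes x :: "'a::euclidean_space"
  assumes "\<epsilon> > 0" "R > 0" "t > 0"
  shows "time_deriv (time_deriv (wave_test \<epsilon> R)) (t, x) - space_laplacian (wave_test \<epsilon> R) (t, x)
      - time_deriv (\<lambda>(s, y). \<mu> / (1 + s) * wave_test \<epsilon> R (s, y)) (t, x)
    = (time_weight \<mu> R t - time_weight \<mu> \<epsilon> t) * bump R x
      - (1 + t) * window \<epsilon> R t * bump_laplacian R x"
proof -
  define w1 where "w1 t = \<kappa>1 (t / R) / R - \<kappa>1 (t / \<epsilon>) / \<epsilon>" for t
  define w2 where "w2 t = \<kappa>2 (t / R) / R\<^sup>2 - \<kappa>2 (t / \<epsilon>) / \<epsilon>\<^sup>2" for t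
  have dw: "(window \<epsilon> R has_real_derivative w1 t) (at t)" for t
    unfolding window_def [abs_def] w1_def by (intro DERIV_diff DERIV_rescaled)
  have dw1: "(w1 has_real_derivative w2 t) (at t)" for t
  proof -
    have "(w1 has_real_derivative \<kappa>2 (t / R) / R / R - \<kappa>2 (t / \<epsilon>) / \<epsilon> / \<epsilon>) (at t)"
      unfolding w1_def [abs_def] by (intro DERIV_diff DERIV_cdivide DERIV_rescaled)
    then show ?thesis by (simp add: w2_def power2_eq_square)
  qed
  have one_plus: "((\<lambda>t. 1 + t) has_real_derivative 1) (at t)" for t :: real
    by (auto intro!: derivative_eq_intros)
  have da: "((\<lambda>t. (1 + t) * window \<epsilon> R t) has_real_derivative window \<epsilon> R t + (1 + t) * w1 t) (at t)" for t
    using DERIV_mult[OF one_plus dw, of t] by (simp add: algebra_simps)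
  have da1: "((\<lambda>t. window \<epsilon> R t + (1 + t) * w1 t) has_real_derivative 2 * w1 t + (1 + t) * w2 t) (at t)" for t
    using DERIV_add[OF dw DERIV_mult[OF one_plus dw1], of t] by (simp add: algebra_simps)
  have diff: "bump R differentiable (at x)" "dir_deriv b (bump R) differentiable (at x)" for b x :: 'a
    by (intro smooth_differentiable smooth_bump smooth_dir_deriv)+
  have zero: "dir_deriv 0 g x = 0" if "g differentiable (at x)" for g and x :: 'a
    unfolding dir_deriv_def using linear_0[OF linear_frechet_derivative[OF that]] .
  have t1: "time_deriv (wave_test \<epsilon> R) =
      (\<lambda>z. (window \<epsilon> R (fst z) + (1 + fst z) * w1 (fst z)) * bump R (snd z :: 'a))"
    unfolding time_deriv_def wave_test_def [abs_def]
    by (rule ext) (use dir_deriv_tensor[OF da diff(1), of 1 0] zero[OF diff(1)] in \<open>force simp: split_paired_all\<close>)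
  have t2: "time_deriv (time_deriv (wave_test \<epsilon> R)) (t, x) = (2 * w1 t + (1 + t) * w2 t) * bump R x"
    unfolding t1 unfolding time_deriv_def
    using dir_deriv_tensor[OF da1 diff(1), of 1 0 t x] zero[OF diff(1)] by simp
  have s1: "dir_deriv (0, b) (wave_test \<epsilon> R) =
      (\<lambda>z. ((1 + fst z) * window \<epsilon> R (fst z)) * dir_deriv b (bump R) (snd z :: 'a))" for b
    unfolding wave_test_def [abs_def]
    by (rule ext) (use dir_deriv_tensor[OF da diff(1), of 0 b] in \<open>force simp: split_paired_all\<close>)
  have s2: "space_laplacian (wave_test \<epsilon> R) (t, x) = (1 + t) * window \<epsilon> R t * bump_laplacian R x"
    unfolding space_laplacian_def s1 bump_laplacian_def sum_distrib_left
    using dir_deriv_tensor[OF da diff(2), of 0] by simp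
  have "((\<lambda>t. \<mu> * window \<epsilon> R t) has_real_derivative \<mu> * w1 t) (at t)"
    by (rule DERIV_cmult[OF dw])
  then have "((\<lambda>t. \<mu> / (1 + t) * ((1 + t) * window \<epsilon> R t)) has_real_derivative \<mu> * w1 t) (at t)"
    by (rule has_field_derivative_transform_within_open[of _ _ _ "{0<..}"]) (use assms(3) in auto)
  from dir_deriv_tensor[OF this diff(1), of 1 0 x] zero[OF diff(1)]
  have "dir_deriv (1, 0) (\<lambda>z. (\<mu> / (1 + fst z) * ((1 + fst z) * window \<epsilon> R (fst z))) * bump R (snd z)) (t, x)
      = \<mu> * w1 t * bump R x"
    by simp
  moreover have "(\<lambda>(s, y). \<mu> / (1 + s) * wave_test \<epsilon> R (s, y)) =
      (\<lambda>z. (\<mu> / (1 + fst z) * ((1 + fst z) * window \<epsilon> R (fst z))) * bump R (snd z :: 'a))"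
    by (simp add: fun_eq_iff wave_test_def)
  ultimately have t3: "time_deriv (\<lambda>(s, y). \<mu> / (1 + s) * wave_test \<epsilon> R (s, y)) (t, x) = \<mu> * w1 t * bump R x"
    by (simp only: time_deriv_def)
  show ?thesis
    unfolding t2 s2 t3 by (simp add: time_weight_def w1_def w2_def algebra_simps add_divide_distrib diff_divide_distrib)
qed

end

section \<open>The test function inequality\<close>

text \<open>One of the two terms dominates alone, according to whether \<open>y \<le> l x\<^sup>p\<^sup>-\<^sup>1\<close> or not.\<close>

lemma weighted_Young:
  fixes x y l p :: real
  assumes "x \<ge> 0" "y \<ge> 0" "l > 0" "p > 1"
  shows "x * y \<le> l * x powr p + l powr (- 1 / (p - 1)) * y powr (p / (p - 1))"
proof (cases "y \<le> l * x powr (p - 1)")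
  case True
  have "x * y \<le> x * (l * x powr (p - 1))"
    using True assms by (intro mult_left_mono) auto
  also have "\<dots> = l * x powr p"
    using assms powr_mult_base[of x "p - 1"] by (simp add: mult_ac)
  finally show ?thesis by (simp add: add_increasing2)
next
  case False
  then have "y > 0" using assms by (smt (verit) mult_nonneg_nonneg powr_ge_zero)
  have "x powr (p - 1) \<le> y / l" using False assms by (simp add: field_simps)
  then have "(x powr (p - 1)) powr (1 / (p - 1)) \<le> (y / l) powr (1 / (p - 1))"
    using assms by (intro powr_mono2) auto
  then have "x \<le> (y / l) powr (1 / (p - 1))"
    using assms by (simp add: powr_powr)
  then have "x * y \<le> (y / l) powr (1 / (p - 1)) * y"
    using assms by (intro mult_right_mono) auto
  also have "\<dots> = l powr (- 1 / (p - 1)) * (y * y powr (1 / (p - 1)))"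
    using assms \<open>y > 0\<close> by (simp add: powr_divide powr_minus_divide)
  also have "y * y powr (1 / (p - 1)) = y powr (p / (p - 1))"
    using assms powr_mult_base[of y "1 / (p - 1)"] by (simp add: field_simps)
  finally show ?thesis using assms by (simp add: add_increasing)
qed

context cutoff
begin

text \<open>The derivatives of the outer cutoff live on \<open>t > R\<close>. There the inner cutoff has vanished, and
  \<open>1 / R \<le> (1 + t) / R\<^sup>2\<close> brings the first order term to the size of the second order one.\<close>

lemma time_weight_bound:
  assumes "0 < \<epsilon>" "2 * \<epsilon> \<le> R" "0 < t"
  shows "\<bar>time_weight \<mu> R t\<bar> \<le> (1 + t) * (C * (1 + \<bar>2 - \<mu>\<bar>) / R\<^sup>2) * window \<epsilon> R t powr r"
proof (cases "t \<le> R")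
  case True
  then show ?thesis
    using assms C_nonneg by (simp add: time_weight_def vanish_left)
next
  case False
  then have w: "window \<epsilon> R t = \<kappa> (t / R)"
    using assms by (simp add: window_def zero field_simps)
  let ?k = "\<kappa> (t / R) powr r"
  have "\<bar>time_weight \<mu> R t\<bar> \<le> (1 + t) * \<bar>\<kappa>2 (t / R)\<bar> / R\<^sup>2 + \<bar>2 - \<mu>\<bar> * \<bar>\<kappa>1 (t / R)\<bar> / R"
    using assms abs_triangle_ineq[of "(1 + t) * \<kappa>2 (t / R) / R\<^sup>2" "(2 - \<mu>) * \<kappa>1 (t / R) / R"]
    by (simp add: time_weight_def abs_mult)
  also have "\<dots> \<le> (1 + t) * (C * ?k) / R\<^sup>2 + \<bar>2 - \<mu>\<bar> * (C * ?k) / R"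
    using assms bounds12 by (intro add_mono divide_right_mono mult_left_mono) auto
  also have "\<bar>2 - \<mu>\<bar> * (C * ?k) / R = R * (\<bar>2 - \<mu>\<bar> * (C * ?k)) / R\<^sup>2"
    using assms by (simp add: power2_eq_square)
  also have "\<dots> \<le> (1 + t) * (\<bar>2 - \<mu>\<bar> * (C * ?k)) / R\<^sup>2"
    using assms False C_nonneg by (intro divide_right_mono mult_right_mono) auto
  finally show ?thesis
    unfolding w by (simp add: algebra_simps add_divide_distrib)
qed

text \<open>The sum of the constants in the bounds for the time weight and for the Laplacian in dimension
  \<open>n\<close>.\<close>

definition Young_const :: "real \<Rightarrow> real \<Rightarrow> real" where
  "Young_const \<mu> n = C * (1 + \<bar>2 - \<mu>\<bar>) + C * (8 + 2 * n)"

lemma Young_const_nonneg: "n \<ge> 0 \<Longrightarrow> 0 \<le> Young_const \<mu> n"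
  using C_nonneg by (simp add: Young_const_def)

lemma wave_test_nonneg: "0 < \<epsilon> \<Longrightarrow> \<epsilon> \<le> R \<Longrightarrow> 0 \<le> t \<Longrightarrow> 0 \<le> wave_test \<epsilon> R (t, x)"
  by (simp add: wave_test_def window_bounds bump_bounds)

lemma wave_test_mono:
  assumes "0 < \<epsilon>'" "\<epsilon>' \<le> \<epsilon>" "\<epsilon> \<le> R" "R \<le> R'" "0 \<le> t"
  shows "wave_test \<epsilon> R (t, x) \<le> wave_test \<epsilon>' R' (t, x)"
proof -
  have "\<kappa> (t / R) \<le> \<kappa> (t / R')" "\<kappa> (t / \<epsilon>') \<le> \<kappa> (t / \<epsilon>)"
    using assms by (auto intro!: antimono divide_left_mono)
  then have "window \<epsilon> R t \<le> window \<epsilon>' R' t" by (simp add: window_def)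
  then show ?thesis
    unfolding wave_test_def using assms
    by (auto intro!: mult_mono bump_mono bump_bounds window_bounds mult_nonneg_nonneg)
qed

text \<open>The left-hand side vanishes for \<open>t \<le> R\<close>, \<open>|x| \<le> R\<close>, where all outer cutoffs are constant. The test
  function of scale \<open>R / 2\<close> is supported in that region, so where the left-hand side is not zero,
  subtracting it costs nothing; elsewhere the difference is nonnegative.\<close>

lemma pointwise_inequality:
  fixes x :: "'a::euclidean_space"
  assumes p: "p > 1" "r = 1 / p" and R: "R > 0" "0 < \<epsilon>" "4 * \<epsilon> \<le> R" and "t > 0" "l > 0"
  shows "y * (time_weight \<mu> R t * bump R x - (1 + t) * window \<epsilon> R t * bump_laplacian R x)
    \<le> l * (\<bar>y\<bar> powr p * wave_test \<epsilon> R (t, x) - \<bar>y\<bar> powr p * wave_test \<epsilon> (R / 2) (t, x))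
      + l powr (- 1 / (p - 1)) * (Young_const \<mu> DIM('a) / R\<^sup>2) powr (p / (p - 1)) * (1 + 2 * R)
        * indicator {..2 * R} t * indicator (cball 0 (2 * R)) x"
    (is "?lhs \<le> l * (?S1 - ?S2) + ?c * _ * _")
proof -
  let ?K = "Young_const \<mu> DIM('a)"
  have "?S2 \<le> ?S1"
    using R \<open>t > 0\<close> by (intro mult_left_mono wave_test_mono) auto
  then have S: "0 \<le> l * (?S1 - ?S2)" using \<open>l > 0\<close> by simp
  have c: "0 \<le> ?c" using R by simp
  have rhs: "0 \<le> l * (?S1 - ?S2) + ?c * indicator {..2 * R} t * indicator (cball 0 (2 * R)) x"
    by (rule add_nonneg_nonneg[OF S mult_nonneg_nonneg[OF mult_nonneg_nonneg[OF c]]]) simp_all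
  consider "t \<le> R \<and> norm x \<le> R" | "t > 2 * R \<or> norm x > 2 * R"
    | "t \<le> 2 * R" "norm x \<le> 2 * R" "t > R \<or> norm x > R" by linarith
  then show ?thesis
  proof cases
    case 1
    then have "?lhs = 0"
      using R by (simp add: time_weight_def vanish_left bump_laplacian_eq_0)
    from order_trans[OF eq_refl[OF this] rhs] show ?thesis .
  next
    case 2
    then have "?lhs = 0"
    proof
      assume t: "t > 2 * R"
      then have "2 \<le> t / R" "2 \<le> t / \<epsilon>" using R by (simp_all add: field_simps)
      then show ?thesis by (simp add: time_weight_def window_def vanish_right zero)
    next
      assume "norm x > 2 * R"
      then show ?thesis using R by (simp add: bump_eq_0 bump_laplacian_eq_0)
    qed
    from order_trans[OF eq_refl[OF this] rhs] show ?thesis .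
  next
    case 3
    let ?w = "window \<epsilon> R t" and ?b = "bump R x"
    have w: "0 \<le> ?w" "?w \<le> 1" and b: "0 \<le> ?b" "?b \<le> 1"
      using R \<open>t > 0\<close> by (auto intro!: window_bounds bump_bounds)
    have r: "0 < r" "r \<le> 1" using p by auto
    have le_powr: "z \<le> z powr r" if "0 \<le> z" "z \<le> 1" for z
      using powr_mono'[of r 1 z] r that by (cases "z = 0") auto
    have "wave_test \<epsilon> (R / 2) (t, x) = 0"
      using 3(3)
    proof
      assume "t > R"
      then have "2 \<le> t / (R / 2)" "2 \<le> t / \<epsilon>" using R by (simp_all add: field_simps)
      then show ?thesis by (simp add: wave_test_def window_def zero)
    next
      assume "norm x > R"
      then show ?thesis using R by (simp add: wave_test_def bump_eq_0)
    qed
    then have S_eq: "?S1 - ?S2 = (1 + t) * (\<bar>y\<bar> * (?w * ?b) powr r) powr p"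
      using p w b by (simp add: wave_test_def powr_mult powr_powr)
    let ?bracket = "time_weight \<mu> R t * ?b - (1 + t) * ?w * bump_laplacian R x"
    have "\<bar>?bracket\<bar> \<le> \<bar>time_weight \<mu> R t\<bar> * ?b + (1 + t) * ?w * \<bar>bump_laplacian R x\<bar>"
      using abs_triangle_ineq4[of "time_weight \<mu> R t * ?b" "(1 + t) * ?w * bump_laplacian R x"]
        w b \<open>t > 0\<close> by (simp add: abs_mult)
    also have "\<dots> \<le> ((1 + t) * (C * (1 + \<bar>2 - \<mu>\<bar>) / R\<^sup>2) * ?w powr r) * ?b powr r
        + (1 + t) * ?w powr r * (C * (8 + 2 * real DIM('a)) / R\<^sup>2 * ?b powr r)"
      using R w b \<open>t > 0\<close> C_nonneg
      by (intro add_mono mult_mono time_weight_bound bump_laplacian_bound le_powr) auto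
    also have "\<dots> = (1 + t) * ((?w * ?b) powr r * (?K / R\<^sup>2))"
      using w b by (simp add: Young_const_def powr_mult algebra_simps add_divide_distrib)
    finally have bracket: "\<bar>?bracket\<bar> \<le> (1 + t) * ((?w * ?b) powr r * (?K / R\<^sup>2))" .
    have "?lhs \<le> \<bar>y\<bar> * \<bar>?bracket\<bar>"
      by (metis abs_ge_self abs_mult)
    also have "\<dots> \<le> \<bar>y\<bar> * ((1 + t) * ((?w * ?b) powr r * (?K / R\<^sup>2)))"
      by (rule mult_left_mono[OF bracket abs_ge_zero])
    also have "\<dots> = (1 + t) * ((\<bar>y\<bar> * (?w * ?b) powr r) * (?K / R\<^sup>2))"
      by (simp only: mult_ac)
    also have "\<dots> \<le> (1 + t) * (l * (\<bar>y\<bar> * (?w * ?b) powr r) powr p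
        + l powr (- 1 / (p - 1)) * (?K / R\<^sup>2) powr (p / (p - 1)))"
      using \<open>t > 0\<close> \<open>l > 0\<close> p Young_const_nonneg[of "DIM('a)" \<mu>]
      by (intro mult_left_mono weighted_Young) auto
    also have "\<dots> = l * (?S1 - ?S2) + (1 + t) * (l powr (- 1 / (p - 1)) * (?K / R\<^sup>2) powr (p / (p - 1)))"
      unfolding S_eq distrib_left by (simp only: mult.left_commute)
    also have "\<dots> \<le> l * (?S1 - ?S2) + (1 + 2 * R) * (l powr (- 1 / (p - 1)) * (?K / R\<^sup>2) powr (p / (p - 1)))"
      using 3 by (intro add_left_mono mult_right_mono) auto
    also have "(1 + 2 * R) * (l powr (- 1 / (p - 1)) * (?K / R\<^sup>2) powr (p / (p - 1)))
        = ?c * indicator {..2 * R} t * indicator (cball 0 (2 * R)) x"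
      using 3(1,2) by (simp add: mult.commute)
    finally show ?thesis .
  qed
qed

definition source :: "real \<Rightarrow> (real \<Rightarrow> 'a::euclidean_space \<Rightarrow> real) \<Rightarrow> real \<Rightarrow> real \<Rightarrow> real" where
  "source p u \<epsilon> R = (LINT t:{0<..}|lebesgue. LINT x|lebesgue. \<bar>u t x\<bar> powr p * wave_test \<epsilon> R (t, x))"

lemma distributional_solution_wave_test:
  fixes u :: "real \<Rightarrow> 'a::euclidean_space \<Rightarrow> real"
  assumes "distributional_solution \<mu> p u" "0 < \<epsilon>" "\<epsilon> \<le> R"
  shows "AE t in lebesgue. t > 0 \<longrightarrow> integrable lebesgue (\<lambda>x. \<bar>u t x\<bar> powr p * wave_test \<epsilon> R (t, x))"
    and "set_integrable lebesgue {0<..} (\<lambda>t. LINT x|lebesgue. \<bar>u t x\<bar> powr p * wave_test \<epsilon> R (t, x))"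
    and "(LINT t:{0<..}|lebesgue. LINT x|lebesgue.
        u t x * ((time_weight \<mu> R t - time_weight \<mu> \<epsilon> t) * bump R x
          - (1 + t) * window \<epsilon> R t * bump_laplacian R x)) = source p u \<epsilon> R"
proof -
  note sol = assms(1)[unfolded distributional_solution_def, rule_format,
      OF wave_test_is_test_function[OF assms(2,3)]]
  show "AE t in lebesgue. t > 0 \<longrightarrow> integrable lebesgue (\<lambda>x. \<bar>u t x\<bar> powr p * wave_test \<epsilon> R (t, x))"
    and "set_integrable lebesgue {0<..} (\<lambda>t. LINT x|lebesgue. \<bar>u t x\<bar> powr p * wave_test \<epsilon> R (t, x))"
    using sol by auto
  have "(LINT t:{0<..}|lebesgue. LINT x|lebesgue.
        u t x * ((time_weight \<mu> R t - time_weight \<mu> \<epsilon> t) * bump R x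
          - (1 + t) * window \<epsilon> R t * bump_laplacian R x)) =
    (LINT t:{0<..}|lebesgue. LINT x|lebesgue. u t x *
        (time_deriv (time_deriv (wave_test \<epsilon> R)) (t, x) - space_laplacian (wave_test \<epsilon> R) (t, x)
         - time_deriv (\<lambda>(s, y). \<mu> / (1 + s) * wave_test \<epsilon> R (s, y)) (t, x)))"
  proof (rule set_lebesgue_integral_cong, simp, intro allI impI)
    fix t :: real assume "t \<in> {0<..}"
    then show "(LINT x|lebesgue. u t x * ((time_weight \<mu> R t - time_weight \<mu> \<epsilon> t) * bump R x
          - (1 + t) * window \<epsilon> R t * bump_laplacian R x)) =
      (LINT x|lebesgue. u t x *
        (time_deriv (time_deriv (wave_test \<epsilon> R)) (t, x) - space_laplacian (wave_test \<epsilon> R) (t, x)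
         - time_deriv (\<lambda>(s, y). \<mu> / (1 + s) * wave_test \<epsilon> R (s, y)) (t, x)))"
      using assms(2,3) by (subst wave_test_adjoint) auto
  qed
  then show "(LINT t:{0<..}|lebesgue. LINT x|lebesgue.
        u t x * ((time_weight \<mu> R t - time_weight \<mu> \<epsilon> t) * bump R x
          - (1 + t) * window \<epsilon> R t * bump_laplacian R x)) = source p u \<epsilon> R"
    using sol by (simp add: source_def)
qed

lemma source_mono:
  assumes "distributional_solution \<mu> p u" "0 < \<epsilon>'" "\<epsilon>' \<le> \<epsilon>" "\<epsilon> \<le> R"
  shows "source p u \<epsilon> R \<le> source p u \<epsilon>' R"
  unfolding source_def
proof (rule set_integral_mono_AE)
  note sol = distributional_solution_wave_test[OF assms(1)]
  show "set_integrable lebesgue {0<..} (\<lambda>t. LINT x|lebesgue. \<bar>u t x\<bar> powr p * wave_test \<epsilon> R (t, x))"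
    "set_integrable lebesgue {0<..} (\<lambda>t. LINT x|lebesgue. \<bar>u t x\<bar> powr p * wave_test \<epsilon>' R (t, x))"
    using assms by (auto intro!: sol(2))
  show "AE t\<in>{0<..} in lebesgue. (LINT x|lebesgue. \<bar>u t x\<bar> powr p * wave_test \<epsilon> R (t, x))
      \<le> (LINT x|lebesgue. \<bar>u t x\<bar> powr p * wave_test \<epsilon>' R (t, x))"
    using sol(1)[of \<epsilon> R] sol(1)[of \<epsilon>' R] assms
    by (auto intro!: integral_mono mult_left_mono wave_test_mono)
qed

lemma source_nonneg:
  assumes "0 < \<epsilon>" "\<epsilon> \<le> R"
  shows "0 \<le> source p u \<epsilon> R"
  unfolding source_def set_lebesgue_integral_def
  by (rule Bochner_Integration.integral_nonneg)
    (use assms in \<open>auto simp: indicator_def intro!: Bochner_Integration.integral_nonneg mult_nonneg_nonneg wave_test_nonneg\<close>)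

lemma in_L2_bump: "R > 0 \<Longrightarrow> in_L2 (bump R :: 'a::euclidean_space \<Rightarrow> real)"
  by (rule in_L2_continuous_compact_support[of _ "2 * R"])
    (auto intro: smooth_continuous smooth_bump bump_eq_0)

lemma in_L2_bump_laplacian: "R > 0 \<Longrightarrow> in_L2 (bump_laplacian R :: 'a::euclidean_space \<Rightarrow> real)"
  by (rule in_L2_continuous_compact_support[of _ "2 * R"])
    (auto intro: continuous_on_bump_laplacian bump_laplacian_eq_0)

text \<open>The last factor comes from the measure \<open>2 R \<cdot> |B(2 R)|\<close> of the support and the weight
  \<open>1 + 2 R \<le> 3 R\<close>, after \<open>R\<^sup>n\<^sup>+\<^sup>2\<close> has been split off.\<close>

definition scaling_const :: "real \<Rightarrow> real \<Rightarrow> nat \<Rightarrow> real" where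
  "scaling_const \<mu> p n = Young_const \<mu> n powr (p / (p - 1)) * (6 * (2 ^ n * unit_ball_vol n))"

text \<open>The left-hand side is of order \<open>R\<^sup>n\<^sup>+\<^sup>2\<^sup>-\<^sup>2\<^sup>q\<close> with \<open>q = p / (p - 1)\<close>, and \<open>n + 2 \<le> 2 q\<close> is equivalent to
  \<open>p \<le> 1 + 2 / n\<close>.\<close>

lemma scaling:
  assumes p: "p > 1" "p \<le> 1 + 2 / real n" "n > 0" and R: "R \<ge> 1"
  shows "(Young_const \<mu> n / R\<^sup>2) powr (p / (p - 1)) * (1 + 2 * R) * (2 * R) * (unit_ball_vol n * (2 * R) ^ n)
    \<le> scaling_const \<mu> p n"
proof -
  let ?q = "p / (p - 1)" and ?K = "Young_const \<mu> n" and ?V = "unit_ball_vol n"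
  have "(p - 1) * (real n + 2) \<le> 2 * p"
    using p by (simp add: field_simps)
  then have q: "real (n + 2) \<le> 2 * ?q"
    using p by (simp add: field_simps)
  have "(R\<^sup>2) powr ?q = R powr (2 * ?q)"
    using R by (simp add: powr_powr flip: powr_numeral)
  also have "\<dots> \<ge> R powr real (n + 2)"
    by (rule powr_mono[OF q R])
  finally have *: "R ^ (n + 2) \<le> (R\<^sup>2) powr ?q"
    using R by (simp only: powr_realpow)
  have K: "(?K / R\<^sup>2) powr ?q = ?K powr ?q / (R\<^sup>2) powr ?q"
    using R Young_const_nonneg[of n \<mu>] by (simp add: powr_divide)
  have "(1 + 2 * R) * (2 * R) \<le> 6 * R\<^sup>2"
    using R mult_left_mono[of 1 R R] by (simp add: power2_eq_square algebra_simps)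
  then have "(1 + 2 * R) * (2 * R) * (?V * (2 * R) ^ n) \<le> 6 * R\<^sup>2 * (?V * (2 * R) ^ n)"
    using R by (intro mult_right_mono) auto
  also have "\<dots> = 6 * (2 ^ n * ?V) * R ^ (n + 2)"
    by (simp add: power_mult_distrib power_add power2_eq_square)
  also have "\<dots> \<le> 6 * (2 ^ n * ?V) * (R\<^sup>2) powr ?q"
    using * by (intro mult_left_mono) auto
  finally have "(?K / R\<^sup>2) powr ?q * ((1 + 2 * R) * (2 * R) * (?V * (2 * R) ^ n))
      \<le> ?K powr ?q / (R\<^sup>2) powr ?q * (6 * (2 ^ n * ?V) * (R\<^sup>2) powr ?q)"
    unfolding K by (rule mult_left_mono) simp
  also have "\<dots> = scaling_const \<mu> p n"
    using R by (simp add: scaling_const_def)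
  finally show ?thesis by (simp only: mult.assoc)
qed

text \<open>The equation, tested with the function of scales \<open>\<epsilon>\<close> and \<open>R\<close>, has the inner time weight on one
  side, which gives at least \<open>c\<close>, and on the other the error term of the outer scale, which is
  estimated pointwise and then integrated first in \<open>x\<close>, then in \<open>t\<close>.\<close>

lemma source_inequality:
  fixes u v :: "real \<Rightarrow> 'a::euclidean_space \<Rightarrow> real"
  assumes uL2: "\<And>t. t \<ge> 0 \<Longrightarrow> in_L2 (u t)" and v: "continuous_L2 v" and uv: "has_L2_time_deriv u v"
    and sol: "distributional_solution \<mu> p u"
    and p: "p > 1" "p \<le> 1 + 2 / real DIM('a)" "r = 1 / p"
    and R: "R \<ge> 1" "0 < \<epsilon>" "4 * \<epsilon> \<le> R" and "l > 0"
    and ge: "\<And>t. 0 \<le> t \<Longrightarrow> t \<le> 2 * \<epsilon> \<Longrightarrow>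
      c \<le> (1 + t) * pairing (v t) (bump R) + (\<mu> - 1) * pairing (u t) (bump R)"
  shows "source p u \<epsilon> R + c \<le> l * (source p u \<epsilon> R - source p u \<epsilon> (R / 2))
      + l powr (- 1 / (p - 1)) * scaling_const \<mu> p DIM('a)"
proof -
  have vL2: "\<And>t. t \<ge> 0 \<Longrightarrow> in_L2 (v t)" using v by (simp add: continuous_L2_def)
  have R0: "R > 0" using R by simp
  note bL2 = in_L2_bump[OF R0] in_L2_bump_laplacian[OF R0]
  define m where "m t = pairing (u t) (bump R)" for t
  define d where "d t = pairing (u t) (bump_laplacian R)" for t
  have dm: "(m has_real_derivative pairing (v t) (bump R)) (at t within {0..})" if "t \<ge> 0" for t
    unfolding m_def [abs_def] by (rule pairing_has_derivative[OF uL2 vL2 uv bL2(1) that])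
  have dd: "(d has_real_derivative pairing (v t) (bump_laplacian R)) (at t within {0..})" if "t \<ge> 0" for t
    unfolding d_def [abs_def] by (rule pairing_has_derivative[OF uL2 vL2 uv bL2(2) that])
  have cont: "continuous_on {0..} m" "continuous_on {0..} d"
    using dm dd by (auto simp: continuous_on_eq_continuous_within intro!: DERIV_continuous)
  define B where "B t = time_weight \<mu> R t * m t - (1 + t) * window \<epsilon> R t * d t" for t
  have B_eq: "B t = (LINT x|lebesgue. u t x * (time_weight \<mu> R t * bump R x
      - (1 + t) * window \<epsilon> R t * bump_laplacian R x))"
    and B_int: "integrable lebesgue (\<lambda>x. u t x * (time_weight \<mu> R t * bump R x
      - (1 + t) * window \<epsilon> R t * bump_laplacian R x))"
    and inner_eq: "(LINT x|lebesgue. u t x * ((time_weight \<mu> R t - time_weight \<mu> \<epsilon> t) * bump R x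
      - (1 + t) * window \<epsilon> R t * bump_laplacian R x)) = B t - time_weight \<mu> \<epsilon> t * m t"
    if "t > 0" for t
  proof -
    have int: "integrable lebesgue (\<lambda>x. u t x * bump R x)"
      "integrable lebesgue (\<lambda>x. u t x * bump_laplacian R x)"
      using that by (auto intro!: in_L2_integrable_mult uL2 bL2)
    have *: "u t x * (\<alpha> * bump R x - \<beta> * bump_laplacian R x)
        = \<alpha> * (u t x * bump R x) - \<beta> * (u t x * bump_laplacian R x)" for \<alpha> \<beta> x
      by (simp add: algebra_simps)
    have lin: "(LINT x|lebesgue. u t x * (\<alpha> * bump R x - \<beta> * bump_laplacian R x)) = \<alpha> * m t - \<beta> * d t" for \<alpha> \<beta>
      unfolding * using int by (simp add: m_def d_def pairing_def)
    show "integrable lebesgue (\<lambda>x. u t x * (time_weight \<mu> R t * bump R x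
        - (1 + t) * window \<epsilon> R t * bump_laplacian R x))"
      unfolding * using int by (intro Bochner_Integration.integrable_diff integrable_mult_right) auto
    show "B t = (LINT x|lebesgue. u t x * (time_weight \<mu> R t * bump R x
        - (1 + t) * window \<epsilon> R t * bump_laplacian R x))"
      and "(LINT x|lebesgue. u t x * ((time_weight \<mu> R t - time_weight \<mu> \<epsilon> t) * bump R x
      - (1 + t) * window \<epsilon> R t * bump_laplacian R x)) = B t - time_weight \<mu> \<epsilon> t * m t"
      unfolding lin B_def by (simp_all add: algebra_simps)
  qed
  have tw_cont: "continuous_on S (time_weight \<mu> \<rho>)" if "\<rho> > 0" for \<rho> S
    unfolding time_weight_def [abs_def] using that
    by (intro continuous_intros continuous_on_rescaled) auto
  have win_cont: "continuous_on S (window \<epsilon> R)" for S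
    unfolding window_def [abs_def] by (intro continuous_intros continuous_on_rescaled)
  have B_sint: "set_integrable lebesgue {0<..} B"
  proof (rule set_integrable_half_line)
    show "continuous_on {0..} B"
      unfolding B_def [abs_def] using R0 by (intro continuous_intros cont tw_cont win_cont)
    show "B t = 0" if "t > 2 * R" for t
    proof -
      have "2 \<le> t / R" "2 \<le> t / \<epsilon>" using that R R0 by (simp_all add: field_simps)
      then show ?thesis by (simp add: B_def time_weight_def window_def vanish_right zero)
    qed
  qed
  have E_sint: "set_integrable lebesgue {0<..} (\<lambda>t. time_weight \<mu> \<epsilon> t * m t)"
  proof (rule set_integrable_half_line)
    show "continuous_on {0..} (\<lambda>t. time_weight \<mu> \<epsilon> t * m t)"
      using R(2) by (intro continuous_intros cont tw_cont)
    show "time_weight \<mu> \<epsilon> t * m t = 0" if "t > 2 * \<epsilon>" for t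
    proof -
      have "2 \<le> t / \<epsilon>" using that R by (simp add: field_simps)
      then show ?thesis by (simp add: time_weight_def vanish_right)
    qed
  qed
  have eps: "\<epsilon> \<le> R" "\<epsilon> \<le> R / 2" using R by auto
  note sol1 = distributional_solution_wave_test[OF sol R(2) eps(1)]
  note sol2 = distributional_solution_wave_test[OF sol R(2) eps(2)]
  have "source p u \<epsilon> R = (LINT t:{0<..}|lebesgue. B t - time_weight \<mu> \<epsilon> t * m t)"
    unfolding sol1(3)[symmetric] by (intro set_lebesgue_integral_cong) (auto simp: inner_eq)
  also have "\<dots> = (LINT t:{0<..}|lebesgue. B t) - (LINT t:{0<..}|lebesgue. time_weight \<mu> \<epsilon> t * m t)"
    by (rule set_integral_diff(2)[OF B_sint E_sint])
  also have "\<dots> \<le> (LINT t:{0<..}|lebesgue. B t) - c"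
    using boundary_term_ge[OF R(2) dm continuous_on_pairing[OF v bL2(1)], of c \<mu>] ge
    by (simp add: m_def)
  finally have le_B: "source p u \<epsilon> R + c \<le> (LINT t:{0<..}|lebesgue. B t)" by simp
  define F1 where "F1 t = (LINT x|lebesgue. \<bar>u t x\<bar> powr p * wave_test \<epsilon> R (t, x))" for t
  define F2 where "F2 t = (LINT x|lebesgue. \<bar>u t x\<bar> powr p * wave_test \<epsilon> (R / 2) (t, x))" for t
  define Q where "Q = l powr (- 1 / (p - 1)) * (Young_const \<mu> DIM('a) / R\<^sup>2) powr (p / (p - 1)) * (1 + 2 * R)"
  define V where "V = unit_ball_vol DIM('a) * (2 * R) ^ DIM('a)"
  have V: "emeasure lebesgue (cball (0::'a) (2 * R)) = ennreal V"
    using R0 by (simp add: V_def emeasure_cball)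
  have V_int: "integrable lebesgue (indicat_real (cball (0::'a) (2 * R)))"
    by (rule integrable_real_indicator) (auto simp: V)
  have V_lint: "(LINT x|lebesgue. indicat_real (cball (0::'a) (2 * R)) x) = V"
    using R0 by (simp add: measure_def V) (simp add: V_def)
  have ind_sint: "set_integrable lebesgue {0<..} (indicat_real {..2 * R})"
    and ind_lint: "(LINT t:{0<..}|lebesgue. indicat_real {..2 * R} t) = 2 * R"
  proof -
    have eq: "indicat_real {0<..} t *\<^sub>R indicat_real {..2 * R} t = indicat_real {0<..2 * R} t" for t
      by (auto simp: indicator_def)
    have em: "emeasure lebesgue {0<..2 * R} = ennreal (2 * R)" using R0 by simp
    show "set_integrable lebesgue {0<..} (indicat_real {..2 * R})"
      unfolding set_integrable_def eq by (rule integrable_real_indicator) (auto simp: em)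
    show "(LINT t:{0<..}|lebesgue. indicat_real {..2 * R} t) = 2 * R"
      unfolding set_lebesgue_integral_def eq using R0 by (simp add: measure_def em)
  qed
  have F_sint: "set_integrable lebesgue {0<..} F1" "set_integrable lebesgue {0<..} F2"
    using sol1(2) sol2(2) by (simp_all add: F1_def [abs_def] F2_def [abs_def])
  have F_comb: "set_integrable lebesgue {0<..} (\<lambda>t. l * (F1 t - F2 t))"
    by (rule set_integrable_mult_right) (rule set_integral_diff(1)[OF F_sint])
  have V_comb: "set_integrable lebesgue {0<..} (\<lambda>t. Q * V * indicat_real {..2 * R} t)"
    by (rule set_integrable_mult_right) (rule ind_sint)
  have "(LINT t:{0<..}|lebesgue. B t) \<le> (LINT t:{0<..}|lebesgue. l * (F1 t - F2 t) + Q * V * indicat_real {..2 * R} t)"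
  proof (rule set_integral_mono_AE[OF B_sint])
    show "set_integrable lebesgue {0<..} (\<lambda>t. l * (F1 t - F2 t) + Q * V * indicat_real {..2 * R} t)"
      by (rule set_integral_add(1)[OF F_comb V_comb])
    show "AE t\<in>{0<..} in lebesgue. B t \<le> l * (F1 t - F2 t) + Q * V * indicat_real {..2 * R} t"
      using sol1(1) sol2(1)
    proof eventually_elim
      case (elim t)
      show ?case
      proof
        assume "t \<in> {0<..}"
        then have t: "t > 0" by simp
        have "B t \<le> (LINT x|lebesgue. l * (\<bar>u t x\<bar> powr p * wave_test \<epsilon> R (t, x) - \<bar>u t x\<bar> powr p * wave_test \<epsilon> (R / 2) (t, x))
            + Q * indicat_real {..2 * R} t * indicat_real (cball (0::'a) (2 * R)) x)"
          unfolding B_eq[OF t]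
        proof (rule integral_mono[OF B_int[OF t]])
          show "integrable lebesgue (\<lambda>x. l * (\<bar>u t x\<bar> powr p * wave_test \<epsilon> R (t, x) - \<bar>u t x\<bar> powr p * wave_test \<epsilon> (R / 2) (t, x))
            + Q * indicat_real {..2 * R} t * indicat_real (cball (0::'a) (2 * R)) x)"
            using elim t V_int by (intro Bochner_Integration.integrable_add integrable_mult_right Bochner_Integration.integrable_diff) auto
          show "u t x * (time_weight \<mu> R t * bump R x - (1 + t) * window \<epsilon> R t * bump_laplacian R x)
            \<le> l * (\<bar>u t x\<bar> powr p * wave_test \<epsilon> R (t, x) - \<bar>u t x\<bar> powr p * wave_test \<epsilon> (R / 2) (t, x))
            + Q * indicat_real {..2 * R} t * indicat_real (cball (0::'a) (2 * R)) x" for x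
            unfolding Q_def by (rule pointwise_inequality[OF p(1,3) R0 R(2,3) t \<open>l > 0\<close>])
        qed
        also have "\<dots> = l * (F1 t - F2 t) + Q * indicat_real {..2 * R} t * V"
          using elim t V_int by (simp add: F1_def F2_def V_lint[simplified])
        finally show "B t \<le> l * (F1 t - F2 t) + Q * V * indicat_real {..2 * R} t"
          by (simp add: mult_ac)
      qed
    qed
  qed
  also have "\<dots> = l * (source p u \<epsilon> R - source p u \<epsilon> (R / 2)) + Q * V * (2 * R)"
  proof -
    have "(LINT t:{0<..}|lebesgue. l * (F1 t - F2 t) + Q * V * indicat_real {..2 * R} t)
      = (LINT t:{0<..}|lebesgue. l * (F1 t - F2 t)) + (LINT t:{0<..}|lebesgue. Q * V * indicat_real {..2 * R} t)"
      by (rule set_integral_add(2)[OF F_comb V_comb])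
    also have "(LINT t:{0<..}|lebesgue. Q * V * indicat_real {..2 * R} t) = Q * V * (2 * R)"
      unfolding set_integral_mult_right ind_lint ..
    also have "(LINT t:{0<..}|lebesgue. l * (F1 t - F2 t)) = l * (source p u \<epsilon> R - source p u \<epsilon> (R / 2))"
      unfolding set_integral_mult_right set_integral_diff(2)[OF F_sint]
      unfolding source_def F1_def F2_def ..
    finally show ?thesis .
  qed
  also have "Q * V * (2 * R) \<le> l powr (- 1 / (p - 1)) * scaling_const \<mu> p DIM('a)"
  proof -
    have "Q * V * (2 * R) = l powr (- 1 / (p - 1)) * ((Young_const \<mu> DIM('a) / R\<^sup>2) powr (p / (p - 1))
        * (1 + 2 * R) * (2 * R) * (unit_ball_vol DIM('a) * (2 * R) ^ DIM('a)))"
      by (simp add: Q_def V_def)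
    also have "\<dots> \<le> l powr (- 1 / (p - 1)) * scaling_const \<mu> p DIM('a)"
      by (intro mult_left_mono scaling p R) auto
    finally show ?thesis .
  qed
  finally show ?thesis using le_B by linarith
qed

end

section \<open>Nonexistence of global solutions\<close>

text \<open>The choice \<open>l = 1/2\<close> bounds \<open>J\<close>. A large \<open>l\<close> makes the last term less than \<open>c / 2\<close>, so that the
  increments of \<open>J\<close> are at least \<open>c / (2 l)\<close>, and \<open>J\<close> is unbounded.\<close>

lemma no_sequence_with_source_inequality:
  fixes J :: "nat \<Rightarrow> real"
  assumes nonneg: "\<And>j. 0 \<le> J j" and "c > 0" and "a < 0"
    and ineq: "\<And>j l. l > 0 \<Longrightarrow> J (Suc j) + c \<le> l * (J (Suc j) - J j) + l powr a * D"
  shows False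
proof -
  define X where "X = (1 / 2) powr a * D"
  define B where "B = 2 * X"
  have B: "J (Suc j) \<le> B" for j
  proof -
    have "J (Suc j) + c \<le> 1 / 2 * (J (Suc j) - J j) + X"
      unfolding X_def by (rule ineq) simp
    then show ?thesis
      unfolding B_def using nonneg[of j] \<open>c > 0\<close> by argo
  qed
  have "((\<lambda>l. l powr a * D) \<longlongrightarrow> 0 * D) at_top"
    by (intro tendsto_mult tendsto_const tendsto_neg_powr[OF \<open>a < 0\<close>] filterlim_ident)
  then have "\<forall>\<^sub>F l in at_top. l powr a * D < c / 2"
    using \<open>c > 0\<close> by (intro order_tendstoD(2)) auto
  then have "\<forall>\<^sub>F l in at_top. l powr a * D < c / 2 \<and> l > 0"
    using eventually_gt_at_top[of 0] by eventually_elim auto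
  then obtain l where l: "l powr a * D < c / 2" "l > 0"
    using eventually_happens by force
  have step: "c / (2 * l) \<le> J (Suc j) - J j" for j
  proof -
    have "c / 2 \<le> l * (J (Suc j) - J j)"
      using ineq[OF l(2), of j] l(1) nonneg[of "Suc j"] by linarith
    then show ?thesis using l(2) by (simp add: field_simps)
  qed
  have grow: "real j * (c / (2 * l)) \<le> J j" for j
  proof (induction j)
    case 0
    show ?case using nonneg[of 0] by simp
  next
    case (Suc j)
    have "real (Suc j) * (c / (2 * l)) = real j * (c / (2 * l)) + c / (2 * l)"
      by (simp only: of_nat_Suc distrib_right mult_1_left add.commute)
    with Suc step[of j] show ?case by linarith
  qed
  have "c / (2 * l) > 0" using \<open>c > 0\<close> l(2) by simp
  then obtain n where "B < real n * (c / (2 * l))" using reals_Archimedean3 by blast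
  also have "\<dots> \<le> real (Suc n) * (c / (2 * l))"
    using \<open>c / (2 * l) > 0\<close> by (intro mult_right_mono) auto
  also have "\<dots> \<le> B" using order_trans[OF grow B] .
  finally show False by simp
qed

lemma compactly_supported_radius:
  fixes f :: "'a::euclidean_space \<Rightarrow> real"
  assumes "compactly_supported f"
  obtains \<rho> where "AE x in lebesgue. norm x > \<rho> \<longrightarrow> f x = 0"
proof -
  obtain K where K: "compact K" "AE x in lebesgue. x \<notin> K \<longrightarrow> f x = 0"
    using assms by (auto simp: compactly_supported_def)
  from K(1) obtain \<rho> where \<rho>: "\<And>x. x \<in> K \<Longrightarrow> norm x \<le> \<rho>"
    using compact_imp_bounded[OF K(1)] by (auto simp: bounded_iff)
  then have "AE x in lebesgue. norm x > \<rho> \<longrightarrow> f x = 0"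
    using K(2) by eventually_elim (use \<rho> in fastforce)
  then show ?thesis by (rule that)
qed

text \<open>Once the scale exceeds the radius of the supports of the data, the boundary term tends to
  \<open>\<integral> ((\<mu> - 1) u\<^sub>0 + u\<^sub>1)\<close> as \<open>\<epsilon> \<rightarrow> 0\<close>, at a rate that depends on the scale;
  hence each outer scale gets an inner scale of its own.\<close>

lemma no_global_solution:
  fixes u :: "real \<Rightarrow> 'a::euclidean_space \<Rightarrow> real"
  assumes p: "1 < p" "p \<le> 1 + 2 / real DIM('a)"
    and u0: "in_L2 u0" and u1: "in_L2 u1"
    and supp: "compactly_supported u0" "compactly_supported u1"
    and pos: "(LINT x|lebesgue. (\<mu> - 1) * u0 x + u1 x) > 0"
    and sol: "global_solution \<mu> p u0 u1 u"
  shows False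
proof -
  define r where "r = 1 / p"
  have "0 < r" "r < 1" using p by (auto simp: r_def)
  then obtain \<kappa> C where "cutoff \<kappa> C r"
    by (rule cutoff_exists)
  then interpret cutoff \<kappa> C r .
  from sol obtain v where v: "continuous_L2 v" "has_L2_time_deriv u v" "AE x in lebesgue. v 0 x = u1 x"
    and u: "continuous_H1 u" "distributional_solution \<mu> p u" "AE x in lebesgue. u 0 x = u0 x"
    by (auto simp: global_solution_def)
  have uL2: "in_L2 (u t)" if "t \<ge> 0" for t
    using u(1) that by (auto simp: continuous_H1_def in_H1_def)
  have vL2: "in_L2 (v t)" if "t \<ge> 0" for t
    using v(1) that by (auto simp: continuous_L2_def)
  obtain \<rho>0 where "AE x in lebesgue. norm x > \<rho>0 \<longrightarrow> u0 x = 0"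
    by (rule compactly_supported_radius[OF supp(1)])
  moreover obtain \<rho>1 where "AE x in lebesgue. norm x > \<rho>1 \<longrightarrow> u1 x = 0"
    by (rule compactly_supported_radius[OF supp(2)])
  moreover define \<rho> where "\<rho> = max 1 (max \<rho>0 \<rho>1)"
  ultimately have supp': "AE x in lebesgue. norm x > \<rho> \<longrightarrow> u0 x = 0 \<and> u1 x = 0" and "\<rho> \<ge> 1"
    by auto
  define I where "I = (LINT x|lebesgue. (\<mu> - 1) * u0 x + u1 x)"
  define W where "W R t = (1 + t) * pairing (v t) (bump R) + (\<mu> - 1) * pairing (u t) (bump R)" for R t
  have W0: "W R 0 = I" if "R \<ge> \<rho>" for R
  proof -
    have R: "R > 0" using that \<open>\<rho> \<ge> 1\<close> by simp
    have int: "integrable lebesgue (\<lambda>x. v 0 x * bump R x)" "integrable lebesgue (\<lambda>x. u 0 x * bump R x)"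
      by (auto intro!: in_L2_integrable_mult uL2 vL2 in_L2_bump R)
    then have "W R 0 = (LINT x|lebesgue. v 0 x * bump R x + (\<mu> - 1) * (u 0 x * bump R x))"
      by (simp add: W_def pairing_def)
    also have "\<dots> = I"
      unfolding I_def
    proof (rule integral_cong_AE)
      show "(\<lambda>x. v 0 x * bump R x + (\<mu> - 1) * (u 0 x * bump R x)) \<in> borel_measurable lebesgue"
        using int by auto
      show "(\<lambda>x. (\<mu> - 1) * u0 x + u1 x) \<in> borel_measurable lebesgue"
        using u0 u1 by (auto simp: in_L2_def)
      show "AE x in lebesgue. v 0 x * bump R x + (\<mu> - 1) * (u 0 x * bump R x) = (\<mu> - 1) * u0 x + u1 x"
        using u(3) v(3) supp'
      proof eventually_elim
        case (elim x)
        show ?case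
        proof (cases "norm x > \<rho>")
          case False
          then have "bump R x = 1" using that R by (intro bump_eq_1) auto
          then show ?thesis using elim by simp
        qed (use elim in simp)
      qed
    qed
    finally show ?thesis .
  qed
  have "I > 0" using pos by (simp add: I_def)
  define Rs where "Rs j = \<rho> * 2 ^ j" for j
  have Rs: "Rs j \<ge> \<rho>" "Rs j \<ge> 1" for j
  proof -
    show "Rs j \<ge> \<rho>" using \<open>\<rho> \<ge> 1\<close> mult_left_mono[of 1 "2 ^ j" \<rho>] by (simp add: Rs_def)
    then show "Rs j \<ge> 1" using \<open>\<rho> \<ge> 1\<close> by simp
  qed
  have "\<exists>\<delta>. \<delta> > 0 \<and> \<delta> \<le> 1 / 4 \<and> (\<forall>t\<in>{0..2 * \<delta>}. I / 2 \<le> W (Rs j) t)" for j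
  proof -
    have bL2: "in_L2 (bump (Rs j) :: 'a \<Rightarrow> real)" using Rs(2)[of j] by (intro in_L2_bump) simp
    have "continuous_on {0..} (\<lambda>t. pairing (u t) (bump (Rs j)))"
      using pairing_has_derivative[OF uL2 vL2 v(2) bL2]
      by (auto simp: continuous_on_eq_continuous_within intro!: DERIV_continuous)
    then have "continuous_on {0..} (W (Rs j))"
      unfolding W_def [abs_def] using continuous_on_pairing[OF v(1) bL2]
      by (intro continuous_intros)
    then have "(W (Rs j) \<longlongrightarrow> I) (at 0 within {0..})"
      using W0[OF Rs(1)[of j]] by (auto simp: continuous_on_def)
    then have "\<forall>\<^sub>F t in at 0 within {0..}. I / 2 < W (Rs j) t"
      using \<open>I > 0\<close> by (intro order_tendstoD(1)) auto
    then obtain d where d: "d > 0" "\<And>t. t \<ge> 0 \<Longrightarrow> t \<noteq> 0 \<Longrightarrow> \<bar>t\<bar> < d \<Longrightarrow> I / 2 < W (Rs j) t"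
      by (auto simp: eventually_at dist_real_def)
    have "I / 2 \<le> W (Rs j) t" if "t \<in> {0..2 * min (1 / 4) (d / 4)}" for t
    proof (cases "t = 0")
      case True
      then show ?thesis using W0[OF Rs(1)[of j]] \<open>I > 0\<close> by simp
    next
      case False
      have "0 \<le> t" "t \<le> 2 * min (1 / 4) (d / 4)" "min (1 / 4) (d / 4) \<le> d / 4"
        using that by auto
      then show ?thesis using d(1) d(2)[of t] False by simp
    qed
    then show ?thesis
      using d(1) by (intro exI[of _ "min (1 / 4) (d / 4)"]) auto
  qed
  then have "\<forall>j. \<exists>\<delta>. \<delta> > 0 \<and> \<delta> \<le> 1 / 4 \<and> (\<forall>t\<in>{0..2 * \<delta>}. I / 2 \<le> W (Rs j) t)" ..
  from choice[OF this] obtain \<delta> where "\<forall>j. \<delta> j > 0 \<and> \<delta> j \<le> 1 / 4 \<and>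
      (\<forall>t\<in>{0..2 * \<delta> j}. I / 2 \<le> W (Rs j) t)" ..
  then have \<delta>: "\<delta> j > 0" "\<delta> j \<le> 1 / 4"
    "0 \<le> t \<Longrightarrow> t \<le> 2 * \<delta> j \<Longrightarrow> I / 2 \<le> W (Rs j) t" for j t
    by simp_all
  (* The inner scales must also decrease, for the sources at consecutive outer scales to be compared. *)
  define \<epsilon> where "\<epsilon> j = Min (\<delta> ` {..j})" for j
  have \<epsilon>: "\<epsilon> j > 0" "\<epsilon> j \<le> \<delta> j" "\<epsilon> (Suc j) \<le> \<epsilon> j" for j
    using \<delta>(1) by (auto simp: \<epsilon>_def intro!: Min_antimono)
  have \<epsilon>': "4 * \<epsilon> j \<le> Rs i" for i j
    using \<epsilon>(2)[of j] \<delta>(2)[of j] Rs(2)[of i] by simp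
  define J where "J j = source p u (\<epsilon> j) (Rs j)" for j
  show False
  proof (rule no_sequence_with_source_inequality[of J "I / 2" "- 1 / (p - 1)"])
    show "0 \<le> J j" for j
      unfolding J_def using \<epsilon>(1)[of j] \<epsilon>'[of j j] by (intro source_nonneg) auto
    show "I / 2 > 0" "- 1 / (p - 1) < 0" using \<open>I > 0\<close> p(1) by auto
    fix j :: nat and l :: real assume "l > 0"
    have half: "Rs (Suc j) / 2 = Rs j" by (simp add: Rs_def)
    have "I / 2 \<le> (1 + t) * pairing (v t) (bump (Rs (Suc j))) + (\<mu> - 1) * pairing (u t) (bump (Rs (Suc j)))"
      if "0 \<le> t" "t \<le> 2 * \<epsilon> (Suc j)" for t
      using \<delta>(3)[of t "Suc j"] that \<epsilon>(2)[of "Suc j"] by (simp add: W_def)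
    from source_inequality[OF uL2 v(1,2) u(2) p r_def Rs(2) \<epsilon>(1) \<epsilon>' \<open>l > 0\<close> this]
    have "J (Suc j) + I / 2 \<le> l * (J (Suc j) - source p u (\<epsilon> (Suc j)) (Rs j))
        + l powr (- 1 / (p - 1)) * scaling_const \<mu> p DIM('a)"
      by (simp add: J_def half)
    moreover have "J j \<le> source p u (\<epsilon> (Suc j)) (Rs j)"
      unfolding J_def using \<epsilon>[of j] \<epsilon>(1)[of "Suc j"] \<epsilon>'[of j j] by (intro source_mono[OF u(2)]) auto
    then have "l * (J (Suc j) - source p u (\<epsilon> (Suc j)) (Rs j)) \<le> l * (J (Suc j) - J j)"
      using \<open>l > 0\<close> by (intro mult_left_mono) auto
    ultimately show "J (Suc j) + I / 2 \<le> l * (J (Suc j) - J j)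
        + l powr (- 1 / (p - 1)) * scaling_const \<mu> p DIM('a)"
      by linarith
  qed
qed

theorem theorem1p3:
  fixes p \<mu> :: real
    and u0 u1 :: "real ^ 'n \<Rightarrow> real"
  assumes "1 < p" and "p \<le> 1 + 2 / real CARD('n)"
    and "\<mu> > 1"
    and "in_H1 u0" and "in_L2 u1"
    and "compactly_supported u0" and "compactly_supported u1"
    and "(LINT x|lebesgue. (\<mu> - 1) * u0 x + u1 x) > 0"
  shows "\<not> (\<exists>u. global_solution \<mu> p u0 u1 u)"
proof
  assume "\<exists>u. global_solution \<mu> p u0 u1 u"
  then obtain u where "global_solution \<mu> p u0 u1 u" ..
  moreover have "in_L2 u0" using assms(4) by (simp add: in_H1_def)
  moreover have "p \<le> 1 + 2 / real DIM(real ^ 'n)" using assms(2) by simp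
  ultimately show False
    using no_global_solution[OF assms(1)] assms(5-8) by blast
qed

end
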